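(* Let $d\geq 2$ and $p$ an odd prime such that $p\nmid d(d-1)$. Let $\lambda\in\mathbb{F}_p^{\times}$. If $d$ is even, then $${_{d-1}G}_{d-1}\left[\begin{array}{cccc}\frac1d,&\frac2d,&\ldots,&\frac{d-1}{d}\\ 0,&\frac1{d-1},&\ldots,&\frac{d-2}{d-1}\end{array}\Big|\ \lambda\right]=\phi(-\lambda(d-1))\;{_{d-1}G}_{d-1}\left[\begin{array}{c}\frac{1}{2(d-1)},\ \frac{3}{2(d-1)},\ \ldots,\ \frac{d-1}{2(d-1)},\ \frac{d+1}{2(d-1)},\ \ldots,\ \frac{2(d-1)-1}{2(d-1)}\\ 0,\ \frac1d,\ \ldots,\ \frac{\frac d2-1}{d},\ \frac{\frac d2+1}{d},\ \ldots,\ \frac{d-1}{d}\end{array}\Big|\ \frac1\lambda\right],$$ where on the right the upper parameters are $\frac{2k-1}{2(d-1)}$ for $1\le k\le d-1$ and the lower parameters are $\frac hd$ for $0\le h\le d-1$, $h\ne\frac d2$. If $d\ge 3$ is odd, then $${_{d-1}G}_{d-1}\left[\begin{array}{cccc}\frac1d,&\frac2d,&\ldots,&\frac{d-1}{d}\\ 0,&\frac1{d-1},&\ldots,&\frac{d-2}{d-1}\end{array}\Big|\ \lambda\right]=\phi(d\lambda)\;{_{d-1}G}_{d-1}\left[\begin{array}{c}0,\ \frac{1}{d-1},\ \ldots,\ \frac{d-3}{2(d-1)},\ \frac{d-1}{2(d-1)},\ \ldots,\ \frac{d-3}{d-1},\ \frac{d-2}{d-1}\\ \frac1{2d},\ \frac3{2d},\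 \ldots,\ \frac{d-2}{2d},\ \frac{d+2}{2d},\ \ldots,\ \frac{2d-3}{2d},\ \frac{2d-1}{2d}\end{array}\Big|\ \frac1\lambda\right],$$ where on the right the upper parameters are $\frac h{d-1}$ for $0\le h\le d-2$ and the lower parameters are $\frac{2k-1}{2d}$ for $1\le k\le d$, $2k-1\neq d$.
   Context: $\phi$ is the quadratic character on $\mathbb{F}_p$, with $\phi(0)=0$. McCarthy's $p$-adic hypergeometric series: $\Gamma_p:\mathbb{Z}_p\to\mathbb{Z}_p^\times$ is the $p$-adic gamma function, i.e. the unique continuous function with $\Gamma_p(0)=1$ and $\Gamma_p(n)=(-1)^n\prod_{0<j<n,\,p\nmid j}j$ for positive integers $n$. $\omega:\mathbb{F}_p^\times\to\mathbb{Z}_p^\times$ is the Teichmüller character ($\omega(a)$ is the $(p-1)$-th root of unity with $\omega(a)\equiv a \pmod p$) and $\overline{\omega}$ its inverse; all characters, including the trivial one $\overline\omega^0$, are extended to $\mathbb{F}_p$ by the value $0$ at $0$. $\lfloor x\rfloor$ is the floor and $\langle x\rangle=x-\lfloor x\rfloor$ the fractional part of $x\in\mathbb{Q}$. For an odd prime $p$, $t\in\mathbb{F}_p$, $n\ge 1$ and $a_i,b_i\in\mathbb{Q}\cap\mathbb{Z}_p$ ($1\le i\le n$), $${_nG}_n\left[\begin{array}{cccc}a_1,&a_2,&\ldots,&a_n\\ b_1,&b_2,&\ldots,&b_n\end{array}\Big|\ t\right]:=\frac{-1}{p-1}\sum_{j=0}^{p-2}(-1)^{jn}\,\overline{\omega}^j(t)\prod_{i=1}^n(-p)^{-\lfloor\langle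 a_i\rangle-\frac{j}{p-1}\rfloor-\lfloor\langle -b_i\rangle+\frac{j}{p-1}\rfloor}\frac{\Gamma_p(\langle a_i-\frac{j}{p-1}\rangle)}{\Gamma_p(\langle a_i\rangle)}\frac{\Gamma_p(\langle -b_i+\frac{j}{p-1}\rangle)}{\Gamma_p(\langle -b_i\rangle)}.$$ *)

theory Defs
  imports
    "HOL-Number_Theory.Number_Theory"
    "HOL-Computational_Algebra.Polynomial_Factorial"
    "Berlekamp_Zassenhaus.Finite_Field"
begin

section \<open>The ring of p-adic integers\<close>

text \<open>
  The prime is \<open>p = CARD('p)\<close> for a type \<open>'p\<close> of class \<open>prime_card\<close>, exactly as for the field
  \<open>'p mod_ring\<close> with p elements. An element of the inverse limit of the rings
  \<open>\<int>/p^k\<int>\<close> is represented by its canonical residues \<open>x k \<in> {0..<p^k}\<close>.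
\<close>

typedef ('p::prime_card) padic_int =
  "{x :: nat \<Rightarrow> int. \<forall>k. 0 \<le> x k \<and> x k < int CARD('p) ^ k \<and> x (Suc k) mod int CARD('p) ^ k = x k}"
  morphisms padic_res Abs_padic_int
  by (rule exI[of _ "\<lambda>_. 0"]) (auto simp: zero_less_card_finite)

setup_lifting type_definition_padic_int

lemma prime_card_gt_0 [simp]: "0 < int CARD('p::prime_card)"
  by simp

lemma padic_res_bounds:
  fixes x :: "'p::prime_card padic_int"
  shows "0 \<le> padic_res x k" "padic_res x k < int CARD('p) ^ k"
  using padic_res[of x] by auto

lemma padic_res_mod_self [simp]:
  fixes x :: "'p::prime_card padic_int"
  shows "padic_res x k mod int CARD('p) ^ k = padic_res x k"
  using padic_res_bounds[of x k] by simp

lemma padic_res_Suc_mod: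
  fixes x :: "'p::prime_card padic_int"
  shows "padic_res x (Suc k) mod int CARD('p) ^ k = padic_res x k"
  using padic_res[of x] by auto

lemma padic_res_mod:
  fixes x :: "'p::prime_card padic_int"
  assumes "k \<le> m"
  shows "padic_res x m mod int CARD('p) ^ k = padic_res x k"
  using assms
proof (induction m rule: dec_induct)
  case (step n)
  have "int CARD('p) ^ k dvd int CARD('p) ^ n"
    using step by (simp add: le_imp_power_dvd)
  then have "padic_res x (Suc n) mod int CARD('p) ^ k
      = padic_res x (Suc n) mod int CARD('p) ^ n mod int CARD('p) ^ k"
    by (simp add: mod_mod_cancel)
  also have "\<dots> = padic_res x k"
    using step padic_res_Suc_mod[of x n] by simp
  finally show ?case .
qed simp

lemma padic_int_eqI: "(\<And>k. padic_res x k = padic_res y k) \<Longrightarrow> x = y"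
  by (metis ext padic_res_inject)

instantiation padic_int :: (prime_card) comm_ring_1
begin

lift_definition zero_padic_int :: "'a padic_int" is "\<lambda>k. 0 mod int CARD('a) ^ k"
  by (simp add: mod_mod_cancel)

lift_definition one_padic_int :: "'a padic_int" is "\<lambda>k. 1 mod int CARD('a) ^ k"
  by (simp add: mod_mod_cancel)

lift_definition plus_padic_int :: "'a padic_int \<Rightarrow> 'a padic_int \<Rightarrow> 'a padic_int"
  is "\<lambda>x y k. (x k + y k) mod int CARD('a) ^ k"
  by (simp add: mod_mod_cancel) (metis mod_add_eq)

lift_definition uminus_padic_int :: "'a padic_int \<Rightarrow> 'a padic_int"
  is "\<lambda>x k. (- x k) mod int CARD('a) ^ k"
  by (simp add: mod_mod_cancel) (metis mod_minus_eq)

lift_definition minus_padic_int :: "'a padic_int \<Rightarrow> 'a padic_int \<Rightarrow> 'a padic_int"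
  is "\<lambda>x y k. (x k - y k) mod int CARD('a) ^ k"
  by (simp add: mod_mod_cancel) (metis mod_diff_eq)

lift_definition times_padic_int :: "'a padic_int \<Rightarrow> 'a padic_int \<Rightarrow> 'a padic_int"
  is "\<lambda>x y k. (x k * y k) mod int CARD('a) ^ k"
  by (simp add: mod_mod_cancel) (metis mod_mult_eq)

lemmas padic_res_simps =
  zero_padic_int.rep_eq one_padic_int.rep_eq plus_padic_int.rep_eq uminus_padic_int.rep_eq
  minus_padic_int.rep_eq times_padic_int.rep_eq

instance
proof
  show "(0::'a padic_int) \<noteq> 1"
  proof
    assume "(0::'a padic_int) = 1"
    then have "padic_res (0::'a padic_int) 1 = padic_res (1::'a padic_int) 1" by simp
    then show False
      by (simp add: padic_res_simps)
  qed
qed (rule padic_int_eqI; simp add: padic_res_simps mod_simps algebra_simps)+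

end

lemma padic_res_of_nat: "padic_res (of_nat n :: 'p::prime_card padic_int) k = int n mod int CARD('p) ^ k"
  by (induction n) (simp_all add: padic_res_simps mod_simps)

lemma padic_res_of_int: "padic_res (of_int n :: 'p::prime_card padic_int) k = n mod int CARD('p) ^ k"
  by (cases n rule: int_diff_cases) (simp add: padic_res_simps padic_res_of_nat mod_simps)

lemma padic_res_power:
  "padic_res (x ^ n :: 'p::prime_card padic_int) k = padic_res x k ^ n mod int CARD('p) ^ k"
  by (induction n) (simp_all add: padic_res_simps mod_simps)

instance padic_int :: (prime_card) idom
proof
  fix x y :: "'a padic_int"
  let ?p = "int CARD('a)"
  assume "x \<noteq> 0" "y \<noteq> 0"
  then obtain k m where k: "padic_res x k \<noteq> 0" and m: "padic_res y m \<noteq> 0"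
    by (metis padic_int_eqI mod_0 zero_padic_int.rep_eq)
  have p: "prime_elem ?p" using prime_card_int by blast
  let ?u = "padic_res x (k + m)" and ?v = "padic_res y (k + m)"
  have u: "\<not> ?p ^ k dvd ?u" and v: "\<not> ?p ^ m dvd ?v"
    using k m padic_res_mod[of k "k + m" x] padic_res_mod[of m "k + m" y]
    by (auto simp: dvd_eq_mod_eq_0)
  then have nz: "?u \<noteq> 0" "?v \<noteq> 0" by auto
  have "multiplicity ?p ?u < k" "multiplicity ?p ?v < m"
    using u v multiplicity_dvd' not_le by blast+
  then have "multiplicity ?p (?u * ?v) < k + m"
    using p nz by (simp add: prime_elem_multiplicity_mult_distrib)
  then have "\<not> ?p ^ (k + m) dvd ?u * ?v"
    using nz p
    by (metis leD mult_eq_0_iff power_dvd_iff_le_multiplicity prime_elem_not_unit)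
  then have "padic_res (x * y) (k + m) \<noteq> 0"
    by (simp add: padic_res_simps dvd_eq_mod_eq_0)
  then show "x * y \<noteq> 0"
    by (metis mod_0 zero_padic_int.rep_eq)
qed

instance padic_int :: (prime_card) ring_char_0
proof
  show "inj (of_nat :: nat \<Rightarrow> 'a padic_int)"
  proof
    fix m n assume eq: "(of_nat m :: 'a padic_int) = of_nat n"
    let ?k = "m + n"
    have "CARD('a) \<ge> 2" using prime_card prime_ge_2_nat by blast
    then have "j < CARD('a) ^ ?k" if "j \<le> ?k" for j
      by (metis that less_le_trans less_exp power_mono zero_le le_less_trans)
    then have "m < CARD('a) ^ ?k" "n < CARD('a) ^ ?k" by auto
    then have "int m < int CARD('a) ^ ?k" "int n < int CARD('a) ^ ?k"
      by (metis of_nat_less_iff of_nat_power)+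
    then show "m = n"
      using arg_cong[OF eq, of "\<lambda>x. padic_res x ?k"] by (simp add: padic_res_of_nat)
  qed
qed

section \<open>The p-adic metric\<close>

text \<open>
  \<open>|x - y| = p^(-v)\<close>, where v is the p-adic valuation of \<open>x - y\<close>, i.e. the least v such that
  x and y differ modulo \<open>p^(v+1)\<close>.
\<close>

instantiation padic_int :: (prime_card) metric_space
begin

definition dist_padic_int :: "'a padic_int \<Rightarrow> 'a padic_int \<Rightarrow> real" where
  "dist_padic_int x y = (if x = y then 0
     else 1 / real CARD('a) ^ (LEAST v. padic_res x (Suc v) \<noteq> padic_res y (Suc v)))"

definition uniformity_padic_int :: "('a padic_int \<times> 'a padic_int) filter" where
  "uniformity_padic_int = (INF e\<in>{0 <..}. principal {(x, y). dist x y < e})"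

definition open_padic_int :: "'a padic_int set \<Rightarrow> bool" where
  "open_padic_int U \<longleftrightarrow> (\<forall>x\<in>U. eventually (\<lambda>(x', y). x' = x \<longrightarrow> y \<in> U) uniformity)"

lemma dist_padic_int_le_iff:
  "dist x y \<le> 1 / real CARD('a) ^ k \<longleftrightarrow> padic_res x k = padic_res (y :: 'a padic_int) k"
proof (cases "x = y")
  case False
  let ?P = "\<lambda>v. padic_res x (Suc v) \<noteq> padic_res y (Suc v)"
  define v where "v = Least ?P"
  have 0: "padic_res z 0 = 0" for z :: "'a padic_int"
    using padic_res_bounds[of z 0] by simp
  have "\<exists>v. ?P v"
    using False 0 by (metis padic_int_eqI not0_implies_Suc)
  then have v: "?P v" unfolding v_def by (rule LeastI_ex)
  have c: "real CARD('a) > 1"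
    using prime_gt_1_nat[OF prime_card[where 'a='a]] by simp
  have "dist x y \<le> 1 / real CARD('a) ^ k \<longleftrightarrow> k \<le> v"
    using False c by (simp add: dist_padic_int_def v_def[symmetric] field_simps)
  also have "\<dots> \<longleftrightarrow> padic_res x k = padic_res y k"
  proof
    assume "k \<le> v"
    show "padic_res x k = padic_res y k"
    proof (cases k)
      case (Suc j)
      then have "\<not> ?P j" using \<open>k \<le> v\<close> not_less_Least[of j ?P] by (simp add: v_def)
      then show ?thesis using Suc by simp
    qed (simp add: 0)
  next
    assume eq: "padic_res x k = padic_res y k"
    show "k \<le> v"
    proof (rule ccontr)
      assume "\<not> k \<le> v"
      then have "padic_res x (Suc v) = padic_res y (Suc v)"
        using padic_res_mod[of "Suc v" k x] padic_res_mod[of "Suc v" k y] eq by simp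
      with v show False by simp
    qed
  qed
  finally show ?thesis .
qed (simp add: dist_padic_int_def)

instance
proof
  fix x y z :: "'a padic_int"
  show 1: "dist x y = 0 \<longleftrightarrow> x = y" for x y :: "'a padic_int"
    by (simp add: dist_padic_int_def)
  have nonneg: "dist x y \<ge> 0" for x y :: "'a padic_int"
    by (simp add: dist_padic_int_def)
  have cases: "dist x y = 0 \<or> (\<exists>k. dist x y = 1 / real CARD('a) ^ k)" for x y :: "'a padic_int"
    by (auto simp: dist_padic_int_def)
  have "dist x y \<le> max (dist x z) (dist y z)"
  proof (cases "max (dist x z) (dist y z) = 0")
    case True
    then have "dist x z = 0" "dist y z = 0" using nonneg[of x z] nonneg[of y z] by linarith+
    then have "x = y" using 1 by auto
    then show ?thesis using nonneg by (simp add: 1[THEN iffD2] max_def)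
  next
    case False
    then obtain k where k: "max (dist x z) (dist y z) = 1 / real CARD('a) ^ k"
      using cases[of x z] cases[of y z] by (metis max_def)
    then have "padic_res x k = padic_res z k" "padic_res y k = padic_res z k"
      unfolding dist_padic_int_le_iff[symmetric] by linarith+
    then have "dist x y \<le> 1 / real CARD('a) ^ k"
      by (simp add: dist_padic_int_le_iff)
    with k show ?thesis by simp
  qed
  then show "dist x y \<le> dist x z + dist y z"
    using nonneg[of x z] nonneg[of y z] by linarith
qed (rule uniformity_padic_int_def open_padic_int_def)+

end


lemma padic_int_of_coherent:
  fixes f :: "nat \<Rightarrow> int"
  assumes "\<And>k. [f (Suc k) = f k] (mod int CARD('p) ^ k)"
  obtains x :: "'p::prime_card padic_int" where "\<And>k. padic_res x k = f k mod int CARD('p) ^ k"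
proof
  show "padic_res (Abs_padic_int (\<lambda>k. f k mod int CARD('p) ^ k) :: 'p padic_int) k
      = f k mod int CARD('p) ^ k" for k
    using assms by (subst Abs_padic_int_inverse) (auto simp: mod_mod_cancel cong_def)
qed

lemma padic_res_cong:
  "[padic_res x (Suc k) = padic_res x k] (mod int CARD('p) ^ k)" for x :: "'p::prime_card padic_int"
  using padic_res_Suc_mod[of x k] by (simp add: cong_def)

lemma padic_int_unit_iff:
  fixes x :: "'p::prime_card padic_int"
  shows "x dvd 1 \<longleftrightarrow> padic_res x 1 \<noteq> 0"
proof
  assume "x dvd 1"
  then obtain y where "1 = x * y" by (elim dvdE)
  then have "padic_res (x * y) 1 = padic_res (1 :: 'p padic_int) 1" by simp
  then show "padic_res x 1 \<noteq> 0" by (auto simp: padic_res_simps)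
next
  let ?p = "int CARD('p)"
  assume nz: "padic_res x 1 \<noteq> 0"
  have p: "prime ?p" by (rule prime_card_int)
  have cop: "coprime (padic_res x k) (?p ^ k)" for k
  proof (cases k)
    case (Suc j)
    have "\<not> ?p dvd padic_res x k"
      using nz padic_res_mod[of 1 k x] Suc by (auto simp: dvd_eq_mod_eq_0)
    then have "coprime ?p (padic_res x k)"
      using p by (rule prime_imp_coprime[rotated])
    then show ?thesis by (simp add: coprime_commute)
  qed simp
  then have "\<forall>k. \<exists>y. [padic_res x k * y = 1] (mod ?p ^ k)"
    using cong_solve_coprime_int by blast
  then obtain g where g: "\<And>k. [padic_res x k * g k = 1] (mod ?p ^ k)" by metis
  have "[g (Suc k) = g k] (mod ?p ^ k)" for k
  proof -
    have "[padic_res x (Suc k) * g (Suc k) = 1] (mod ?p ^ k)"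
      using g[of "Suc k"] by (rule cong_dvd_modulus) simp
    moreover have "[padic_res x (Suc k) * g (Suc k) = padic_res x k * g (Suc k)] (mod ?p ^ k)"
      by (intro cong_mult padic_res_cong) auto
    ultimately have "[padic_res x k * g (Suc k) = padic_res x k * g k] (mod ?p ^ k)"
      using g[of k] by (meson cong_sym cong_trans)
    then show ?thesis using cop[of k] by (simp add: cong_mult_lcancel)
  qed
  then obtain y :: "'p padic_int" where y: "\<And>k. padic_res y k = g k mod ?p ^ k"
    using padic_int_of_coherent by blast
  have "x * y = 1"
    by (rule padic_int_eqI) (use g in \<open>simp add: padic_res_simps y mod_simps cong_def\<close>)
  then show "x dvd 1" by (metis dvdI)
qed

type_synonym 'p padic = "'p padic_int fract"

section \<open>Rational numbers as p-adic integers\<close>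

text \<open>Only meaningful if p does not divide the denominator of r.\<close>

definition padic_of_rat :: "rat \<Rightarrow> 'p::prime_card padic_int" where
  "padic_of_rat r = (THE x. of_int (snd (quotient_of r)) * x = of_int (fst (quotient_of r)))"

lemma ex1_padic_of_rat:
  assumes "\<not> int CARD('p) dvd snd (quotient_of r)"
  shows "\<exists>!x :: 'p::prime_card padic_int.
    of_int (snd (quotient_of r)) * x = of_int (fst (quotient_of r))"
proof -
  let ?d = "of_int (snd (quotient_of r)) :: 'p padic_int"
  have "?d dvd 1"
    using assms by (simp add: padic_int_unit_iff padic_res_of_int dvd_eq_mod_eq_0)
  then have "?d dvd of_int (fst (quotient_of r))" by (rule unit_imp_dvd)
  moreover have "?d \<noteq> 0"
    using quotient_of_denom_pos'[of r] by simp
  ultimately show ?thesis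
    by (metis dvd_def mult_cancel_left)
qed

section \<open>The p-adic gamma function\<close>

definition padic_gamma :: "'p::prime_card padic_int \<Rightarrow> 'p padic_int" where
  "padic_gamma = (THE f. range f \<subseteq> {u. u dvd 1} \<and> continuous_on UNIV f \<and> f 0 = 1 \<and>
     (\<forall>n>0. f (of_nat n) = (- 1) ^ n * (\<Prod>j | 0 < j \<and> j < n \<and> \<not> CARD('p) dvd j. of_nat j)))"

lemma prod_units_mod_prime_power:
  assumes p: "prime p" "odd p" and k: "k > 0"
  shows "[(\<Prod>j\<in>totatives (p ^ k). int j) = -1] (mod int p ^ k)"
proof -
  let ?m = "p ^ k" and ?t = "totient (p ^ k)"
  obtain g where g: "residue_primroot ?m g"
    using residue_primroot_odd_prime_power_exists[OF p] k by metis
  have "p \<ge> 3" using p prime_ge_2_nat[of p] by (cases "p = 2") auto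
  moreover have "p ^ 1 \<le> p ^ k" using k \<open>p \<ge> 3\<close> by (intro power_increasing) auto
  ultimately have m: "?m > 2" by simp
  have even: "even ?t" using totient_even m by blast
  then obtain h where h: "?t = 2 * h" by (elim evenE)
  have t0: "?t > 0" using \<open>p \<ge> 3\<close> by simp
  have "(\<Prod>j\<in>totatives ?m. int j) = (\<Prod>i<?t. int (g ^ i mod ?m))"
    by (rule prod.reindex_bij_betw[symmetric]) (use residue_primroot_is_generator[OF _ g] m in auto)
  also have "[\<dots> = (\<Prod>i<?t. int g ^ i)] (mod int ?m)"
    by (rule cong_prod) (metis cong_int_iff cong_mod_left cong_refl of_nat_power)
  also have "(\<Prod>i<?t. int g ^ i) = int g ^ (\<Sum>i<?t. i)"
    by (simp add: power_sum)
  also have "(\<Sum>i<?t. i) = h * (?t - 1)"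
    using Sum_Ico_nat[of 0 ?t] h by (simp add: atLeast0LessThan mult.assoc)
  finally have 1: "[(\<Prod>j\<in>totatives ?m. int j) = (int g ^ h) ^ (?t - 1)] (mod int ?m)"
    by (simp add: power_mult)
  have ord: "ord ?m g = ?t" and cop: "coprime ?m g"
    using g by (auto simp: residue_primroot_def)
  have "[g ^ h \<noteq> 1] (mod ?m)"
    using ord h t0 by (metis ord_minimal nat_0_less_mult_iff less_add_same_cancel1 mult_2)
  then have ne: "\<not> [int g ^ h = 1] (mod int ?m)"
    by (metis cong_int_iff of_nat_1 of_nat_power)
  have "[g ^ ?t = 1] (mod ?m)"
    using euler_theorem[of g ?m] cop by (simp only: coprime_commute)
  then have "[int g ^ ?t = 1] (mod int ?m)"
    by (metis cong_int_iff of_nat_1 of_nat_power)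
  then have "int ?m dvd int g ^ ?t - 1" by (simp add: cong_iff_dvd_diff)
  also have "int g ^ ?t - 1 = (int g ^ h - 1) * (int g ^ h + 1)"
  proof -
    have "int g ^ ?t = int g ^ h * int g ^ h" by (simp only: h mult_2 power_add)
    then show ?thesis by (simp add: algebra_simps)
  qed
  finally have dvd: "int p ^ k dvd (int g ^ h - 1) * (int g ^ h + 1)" by simp
  have "\<not> (int p dvd int g ^ h - 1 \<and> int p dvd int g ^ h + 1)"
  proof
    assume "int p dvd int g ^ h - 1 \<and> int p dvd int g ^ h + 1"
    then have "int p dvd (int g ^ h + 1) - (int g ^ h - 1)" by (blast intro: dvd_diff)
    then have "int p dvd 2" by simp
    then have "int p \<le> 2" by (rule zdvd_imp_le) simp
    then show False using \<open>p \<ge> 3\<close> by simp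
  qed
  then have "coprime (int p) (int g ^ h - 1) \<or> coprime (int p) (int g ^ h + 1)"
    using p by (meson prime_imp_coprime prime_nat_int_transfer)
  moreover have "\<not> int p ^ k dvd int g ^ h - 1"
    using ne by (simp add: cong_iff_dvd_diff)
  ultimately have "int p ^ k dvd int g ^ h + 1"
    using dvd by (metis coprime_dvd_mult_left_iff coprime_dvd_mult_right_iff coprime_power_left_iff)
  then have "[int g ^ h = -1] (mod int ?m)" by (simp add: cong_iff_dvd_diff)
  then have "[(int g ^ h) ^ (?t - 1) = (-1) ^ (?t - 1)] (mod int ?m)" by (rule cong_pow)
  moreover have "odd (?t - 1)" using even t0 by simp
  ultimately show ?thesis using 1 by (simp add: cong_def)
qed


definition gamma_nat :: "nat \<Rightarrow> nat \<Rightarrow> int" where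
  "gamma_nat p n = (- 1) ^ n * (\<Prod>j | 0 < j \<and> j < n \<and> \<not> p dvd j. int j)"

lemma gamma_nat_altdef:
  "gamma_nat p n = (- 1) ^ n * (\<Prod>j<n. if p dvd j then 1 else int j)"
proof -
  have "(\<Prod>j<n. if p dvd j then 1 else int j) = (\<Prod>j | 0 < j \<and> j < n \<and> \<not> p dvd j. int j)"
    by (rule prod.mono_neutral_cong_right) (auto intro: Nat.gr0I)
  then show ?thesis by (simp add: gamma_nat_def)
qed

lemma prime_not_dvd_gamma_nat: "prime p \<Longrightarrow> \<not> int p dvd gamma_nat p n"
proof
  assume p: "prime p" and dvd: "int p dvd gamma_nat p n"
  have "\<not> int p dvd (-1) ^ n"
    using p by (metis minus_one_power_iff dvd_minus_iff not_prime_unit prime_nat_int_transfer)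
  then have "int p dvd (\<Prod>j | 0 < j \<and> j < n \<and> \<not> p dvd j. int j)"
    using dvd p unfolding gamma_nat_def by (meson prime_dvd_mult_iff prime_nat_int_transfer)
  moreover have "finite {j. 0 < j \<and> j < n \<and> \<not> p dvd j}" by simp
  ultimately show False
    using p by (auto simp: prime_dvd_prod_iff simp flip: prime_nat_int_transfer)
qed

lemma gamma_nat_cong_add:
  assumes p: "prime p" "odd p"
  shows "[gamma_nat p (n + p ^ k) = gamma_nat p n] (mod int p ^ k)"
proof (cases "k = 0")
  case False
  then have k: "k > 0" by simp
  define m where "m = p ^ k"
  define u where "u = (\<lambda>j. if p dvd j then 1 else int j)"
  define F where "F n = (\<Prod>j\<in>{n..<n + m}. u j)" for n
  have pm: "p dvd m" using k by (simp add: m_def)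
  have m0: "m > 0" using p by (simp add: m_def prime_gt_0_nat)
  have u_cong: "[u (n + m) = u n] (mod int m)" for n
    using pm by (auto simp: u_def cong_def dvd_add_left_iff)
  have u_cop: "coprime (u n) (int m)" for n
  proof (cases "p dvd n")
    case False
    then have "coprime p n" using p by (simp add: prime_imp_coprime)
    then show ?thesis using False by (simp add: u_def m_def coprime_commute)
  qed (simp add: u_def)
  have F0: "[F 0 = -1] (mod int m)"
  proof -
    have "F 0 = (\<Prod>j\<in>totatives m. int j)"
      unfolding F_def
    proof (rule prod.mono_neutral_cong_right)
      show "totatives m \<subseteq> {0..<0 + m}"
      proof
        fix j assume j: "j \<in> totatives m"
        have "m > 1" unfolding m_def using one_less_power[OF prime_gt_1_nat[OF p(1)] k] .
        moreover have "j \<noteq> m" using j \<open>m > 1\<close> by (auto simp: totatives_def)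
        ultimately show "j \<in> {0..<0 + m}" using j by (auto simp: totatives_def)
      qed
      have cop: "coprime j m \<longleftrightarrow> \<not> p dvd j" for j
      proof -
        have "coprime j m \<longleftrightarrow> coprime j p" using k by (simp add: m_def)
        also have "\<dots> \<longleftrightarrow> \<not> p dvd j"
          using p by (metis coprime_absorb_right coprime_commute not_prime_unit prime_imp_coprime)
        finally show ?thesis .
      qed
      show "\<forall>j\<in>{0..<0 + m} - totatives m. u j = 1"
        by (auto simp: totatives_def cop u_def intro!: Nat.gr0I)
      show "u j = int j" if "j \<in> totatives m" for j
        using that by (auto simp: totatives_def cop u_def)
    qed simp
    then show ?thesis using prod_units_mod_prime_power[OF p k] by (simp add: m_def)
  qed
  have F: "[F n = -1] (mod int m)" for n
  proof (induction n)
    case (Suc n)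
    have "u n * F (Suc n) = (\<Prod>j\<in>{n..<Suc (n + m)}. u j)"
      unfolding F_def by (subst prod.atLeast_Suc_lessThan[of n]) simp_all
    also have "\<dots> = F n * u (n + m)"
      by (simp add: F_def)
    finally have "u n * F (Suc n) = F n * u (n + m)" .
    moreover have "[F n * u (n + m) = -1 * u n] (mod int m)"
      using Suc u_cong by (rule cong_mult)
    ultimately have "[u n * F (Suc n) = u n * (-1)] (mod int m)" by (simp add: mult.commute)
    then show ?case using cong_mult_lcancel[OF u_cop[of n], of "F (Suc n)" "-1"] by (simp only:)
  qed (rule F0)
  have "gamma_nat p (n + m) = (- 1) ^ (n + m) * ((\<Prod>j<n. u j) * F n)"
    unfolding gamma_nat_altdef u_def[symmetric] F_def
    using prod.atLeastLessThan_concat[of 0 n "n + m" u] by (simp add: atLeast0LessThan)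
  also have "\<dots> = - ((- 1) ^ n * (\<Prod>j<n. u j)) * F n"
    using p by (simp add: m_def power_add)
  also have "[\<dots> = - ((- 1) ^ n * (\<Prod>j<n. u j)) * (-1)] (mod int m)"
    using F by (intro cong_mult) auto
  also have "- ((- 1) ^ n * (\<Prod>j<n. u j)) * (-1) = gamma_nat p n"
    by (simp add: gamma_nat_altdef u_def)
  finally show ?thesis by (simp add: m_def)
qed simp

lemma gamma_nat_cong:
  assumes p: "prime p" "odd p" and "[a = b] (mod p ^ k)"
  shows "[gamma_nat p a = gamma_nat p b] (mod int p ^ k)"
proof -
  have *: "[gamma_nat p (n + c * p ^ k) = gamma_nat p n] (mod int p ^ k)" for n c
  proof (induction c)
    case (Suc c)
    then show ?case
      using gamma_nat_cong_add[OF p, of "n + c * p ^ k" k]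
      by (metis add.commute add.left_commute cong_trans mult_Suc)
  qed simp
  show ?thesis
    by (metis * assms(3) cong_def cong_sym cong_trans mod_div_mult_eq)
qed

lemma ex1_padic_gamma:
  assumes odd: "odd CARD('p)"
  shows "\<exists>!f :: 'p::prime_card padic_int \<Rightarrow> 'p padic_int.
    range f \<subseteq> {u. u dvd 1} \<and> continuous_on UNIV f \<and> f 0 = 1 \<and>
    (\<forall>n>0. f (of_nat n) = (- 1) ^ n * (\<Prod>j | 0 < j \<and> j < n \<and> \<not> CARD('p) dvd j. of_nat j))"
    (is "\<exists>!f. ?P f")
proof (rule ex_ex1I)
  let ?p = "CARD('p)"
  let ?g = "gamma_nat ?p"
  have p: "prime ?p" by (rule prime_card)
  have "\<exists>y :: 'p padic_int. \<forall>k. padic_res y k = ?g (nat (padic_res x k)) mod int ?p ^ k"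
    for x :: "'p padic_int"
  proof -
    have "[?g (nat (padic_res x (Suc k))) = ?g (nat (padic_res x k))] (mod int ?p ^ k)" for k
    proof (rule gamma_nat_cong[OF p odd])
      have "[int (nat (padic_res x (Suc k))) = int (nat (padic_res x k))] (mod int (?p ^ k))"
        using padic_res_cong[of x k] by (simp add: padic_res_bounds)
      then show "[nat (padic_res x (Suc k)) = nat (padic_res x k)] (mod ?p ^ k)"
        by (simp only: cong_int_iff)
    qed
    then obtain y :: "'p padic_int"
      where "\<And>k. padic_res y k = ?g (nat (padic_res x k)) mod int ?p ^ k"
      using padic_int_of_coherent[where f = "\<lambda>k. ?g (nat (padic_res x k))"] by blast
    then show ?thesis by blast
  qed
  then obtain f :: "'p padic_int \<Rightarrow> 'p padic_int" where
    f: "\<And>x k. padic_res (f x) k = ?g (nat (padic_res x k)) mod int ?p ^ k" by metis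
  have fn: "f (of_nat n) = of_int (?g n)" for n
  proof (rule padic_int_eqI)
    fix k
    have eq: "padic_res (of_nat n :: 'p padic_int) k = int (n mod ?p ^ k)"
      by (simp add: padic_res_of_nat of_nat_mod)
    have "[?g (n mod ?p ^ k) = ?g n] (mod int ?p ^ k)"
      by (rule gamma_nat_cong[OF p odd]) simp
    then show "padic_res (f (of_nat n)) k = padic_res (of_int (?g n) :: 'p padic_int) k"
      unfolding f eq padic_res_of_int cong_def nat_int .
  qed
  have "f x dvd 1" for x
    using prime_not_dvd_gamma_nat[OF p] by (simp add: padic_int_unit_iff f dvd_eq_mod_eq_0)
  moreover have "dist (f x) (f y) \<le> dist x y" for x y
  proof (cases "x = y")
    case False
    then obtain v where v: "dist x y = 1 / real ?p ^ v" by (auto simp: dist_padic_int_def)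
    then have "padic_res x v = padic_res y v" by (simp add: dist_padic_int_le_iff[symmetric])
    then have "padic_res (f x) v = padic_res (f y) v" by (simp add: f)
    then show ?thesis by (simp add: v dist_padic_int_le_iff)
  qed simp
  then have "continuous_on UNIV f"
    unfolding continuous_on_def
    by (auto intro!: metric_tendsto_imp_tendsto[OF tendsto_ident_at] always_eventually)
  moreover have "f 0 = 1" using fn[of 0] by (simp add: gamma_nat_def)
  moreover have "f (of_nat n) = (- 1) ^ n * (\<Prod>j | 0 < j \<and> j < n \<and> \<not> ?p dvd j. of_nat j)" for n
    by (simp add: fn gamma_nat_def)
  ultimately show "\<exists>f. ?P f" by (intro exI[of _ f]) auto
next
  let ?p = "CARD('p)"
  fix f g :: "'p padic_int \<Rightarrow> 'p padic_int"
  assume f: "?P f" and g: "?P g"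
  show "f = g"
  proof
    fix x :: "'p padic_int"
    define s :: "nat \<Rightarrow> 'p padic_int" where "s k = of_nat (nat (padic_res x k) + ?p ^ k)" for k
    have c: "real ?p > 1"
      using prime_gt_1_nat[OF prime_card[where 'a='p]] by simp
    have bound: "dist (s k) x \<le> (1 / real ?p) ^ k" for k
    proof -
      have "padic_res (s k) k = padic_res x k"
        unfolding s_def padic_res_of_nat by (simp add: padic_res_bounds)
      then show ?thesis by (simp add: dist_padic_int_le_iff power_one_over)
    qed
    have lim: "(\<lambda>k. (1 / real ?p) ^ k) \<longlonglongrightarrow> 0"
      by (rule LIMSEQ_realpow_zero) (use c in auto)
    have "(\<lambda>k. dist (s k) x) \<longlonglongrightarrow> 0"
      by (rule tendsto_sandwich[OF _ _ tendsto_const lim]) (simp_all add: bound)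
    then have s: "s \<longlonglongrightarrow> x"
      by (rule tendsto_dist_iff[THEN iffD2])
    have cont: "continuous_on UNIV f" "continuous_on UNIV g" using f g by blast+
    have "(\<lambda>k. f (s k)) \<longlonglongrightarrow> f x" "(\<lambda>k. g (s k)) \<longlonglongrightarrow> g x"
      using continuous_on_tendsto_compose[OF cont(1) s] continuous_on_tendsto_compose[OF cont(2) s]
      by simp_all
    moreover have "f (s k) = g (s k)" for k
    proof -
      have "nat (padic_res x k) + ?p ^ k > 0" by simp
      then show ?thesis unfolding s_def using f g by (simp only: simp_thms)
    qed
    ultimately show "f x = g x" using LIMSEQ_unique by simp
  qed
qed

section \<open>Characters\<close>

definition quad_char :: "'p::prime_card mod_ring \<Rightarrow> int" where
  "quad_char a = Legendre (to_int_mod_ring a) (int CARD('p))"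

definition padic_reduce :: "'p::prime_card padic_int \<Rightarrow> 'p mod_ring" where
  "padic_reduce x = of_int (padic_res x 1)"

text \<open>Only meaningful for nonzero arguments.\<close>

definition teichmueller :: "'p::prime_card mod_ring \<Rightarrow> 'p padic_int" where
  "teichmueller a = (THE x. x ^ (CARD('p) - 1) = 1 \<and> padic_reduce x = a)"

lemma padic_reduce_eq_iff: "padic_reduce x = padic_reduce y \<longleftrightarrow> padic_res x 1 = padic_res y 1"
proof -
  have "to_int_mod_ring (padic_reduce x) = padic_res x 1" for x :: "'a padic_int"
    using padic_res_bounds[of x 1] by (simp add: padic_reduce_def of_int_of_int_mod_ring)
  then show ?thesis by (metis padic_reduce_def)
qed

lemma cong_power_prime_lift:
  fixes a b :: int
  assumes p: "p > 0" and "[a = b] (mod int p ^ Suc k)"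
  shows "[a ^ p = b ^ p] (mod int p ^ Suc (Suc k))"
proof -
  let ?S = "\<Sum>i<p. b ^ (p - Suc i) * a ^ i"
  have 1: "int p ^ Suc k dvd a - b" using assms by (simp add: cong_iff_dvd_diff)
  have ab: "[a = b] (mod int p)" using assms(2) by (rule cong_dvd_modulus) simp
  have "[?S = (\<Sum>i<p. b ^ (p - Suc i) * b ^ i)] (mod int p)"
    by (intro cong_sum cong_mult cong_pow ab) auto
  also have "(\<Sum>i<p. b ^ (p - Suc i) * b ^ i) = (\<Sum>i<p. b ^ (p - 1))"
    by (intro sum.cong refl) (simp add: power_add[symmetric])
  also have "[\<dots> = 0] (mod int p)" by (simp add: cong_0_iff)
  finally have "int p dvd ?S" by (simp add: cong_0_iff)
  with 1 have "int p ^ Suc k * int p dvd (a - b) * ?S" by (rule mult_dvd_mono)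
  moreover have "a ^ p - b ^ p = (a - b) * ?S" by (rule power_diff_sumr2)
  ultimately show ?thesis by (simp add: cong_iff_dvd_diff mult_ac)
qed

lemma ex1_teichmueller:
  assumes "a \<noteq> 0"
  shows "\<exists>!x :: 'p::prime_card padic_int. x ^ (CARD('p) - 1) = 1 \<and> padic_reduce x = a"
proof (rule ex_ex1I)
  let ?p = "CARD('p)"
  have p: "prime ?p" by (rule prime_card)
  have p0: "?p > 0" by simp
  define b where "b = to_int_mod_ring a"
  have b_range: "b \<in> {0..<int ?p}"
    unfolding b_def range_to_int_mod_ring[symmetric] by simp
  have b: "\<not> int ?p dvd b"
  proof
    assume "int ?p dvd b"
    with b_range have "b = 0" by (metis atLeastLessThan_iff dvd_imp_mod_0 mod_pos_pos_trivial)
    then show False using assms by (simp add: b_def)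
  qed
  have fermat: "[b ^ (?p - 1) = 1] (mod int ?p)"
  proof -
    have b0: "b \<ge> 0" using b_range by simp
    then have "\<not> ?p dvd nat b" using b by (metis int_dvd_int_iff nat_0_le)
    then have "[nat b ^ (?p - 1) = 1] (mod ?p)" by (rule fermat_theorem[OF p])
    then have "[int (nat b ^ (?p - 1)) = int 1] (mod int ?p)" by (simp only: cong_int_iff)
    then show ?thesis using b0 by simp
  qed
  define c where "c = b ^ (?p - 1)"
  have lift: "[c ^ (?p ^ k) = 1] (mod int ?p ^ Suc k)" for k
  proof (induction k)
    case (Suc k)
    have "[(c ^ (?p ^ k)) ^ ?p = 1 ^ ?p] (mod int ?p ^ Suc (Suc k))"
      using Suc by (rule cong_power_prime_lift[OF p0])
    then show ?case by (simp only: power_Suc2[of ?p k] power_mult power_one)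
  qed (use fermat in \<open>simp add: c_def\<close>)
  show "\<exists>x :: 'p padic_int. x ^ (?p - 1) = 1 \<and> padic_reduce x = a"
  proof -
    have step: "b ^ (?p ^ Suc k) = b ^ (?p ^ k) * c ^ (?p ^ k)" for k
    proof -
      have "?p ^ Suc k = ?p ^ k + (?p - 1) * ?p ^ k"
        using p0 by (cases ?p) simp_all
      then show ?thesis by (simp only: c_def power_add power_mult)
    qed
    have lift': "[c ^ (?p ^ k) = 1] (mod int ?p ^ k)" for k
      using lift[of k] by (rule cong_dvd_modulus) simp
    have "[b ^ (?p ^ Suc k) = b ^ (?p ^ k) * 1] (mod int ?p ^ k)" for k
      unfolding step using lift' by (intro cong_mult) auto
    then obtain x :: "'p padic_int" where x: "\<And>k. padic_res x k = b ^ (?p ^ k) mod int ?p ^ k"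
      using padic_int_of_coherent[of "\<lambda>k. b ^ (?p ^ k)"] by auto
    have "x ^ (?p - 1) = 1"
    proof (rule padic_int_eqI)
      fix k
      show "padic_res (x ^ (?p - 1)) k = padic_res (1 :: 'p padic_int) k"
      proof -
        have "(b ^ (?p ^ k)) ^ (?p - 1) = c ^ (?p ^ k)"
          unfolding c_def power_mult[symmetric] by (simp only: mult.commute)
        then show ?thesis
          using lift'[of k] by (simp add: padic_res_power x power_mod padic_res_simps cong_def)
      qed
    qed
    moreover have "padic_reduce x = a"
    proof -
      have "[b ^ ?p = b * 1] (mod int ?p)"
        using cong_scalar_left[OF fermat, of b] p0 by (simp flip: power_Suc)
      then have "padic_res x 1 = b mod int ?p" by (simp add: x cong_def)
      then show ?thesis
        using b_range by (simp add: padic_reduce_def b_def of_int_of_int_mod_ring)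
    qed
    ultimately show ?thesis by blast
  qed
next
  let ?p = "CARD('p)"
  fix x y :: "'p padic_int"
  assume x: "x ^ (?p - 1) = 1 \<and> padic_reduce x = a"
    and y: "y ^ (?p - 1) = 1 \<and> padic_reduce y = a"
  have pow: "z ^ ?p = z" if "z ^ (?p - 1) = 1" for z :: "'p padic_int"
  proof -
    have "z ^ ?p = z ^ (?p - 1) * z" by (rule power_minus_mult[symmetric]) simp
    then show ?thesis using that by simp
  qed
  have eq: "padic_res x (Suc k) = padic_res y (Suc k)" for k
  proof (induction k)
    case 0
    have "padic_res x 1 = padic_res y 1"
      using x y unfolding padic_reduce_eq_iff[symmetric] by simp
    then show ?case by simp
  next
    case (Suc k)
    have *: "[padic_res z (Suc (Suc k)) = padic_res z (Suc k)] (mod int ?p ^ Suc k)"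
      for z :: "'p padic_int" by (rule padic_res_cong)
    have "[padic_res x (Suc (Suc k)) = padic_res y (Suc (Suc k))] (mod int ?p ^ Suc k)"
      using *[of x] *[of y] Suc by (metis cong_sym cong_trans)
    then have "[padic_res x (Suc (Suc k)) ^ ?p = padic_res y (Suc (Suc k)) ^ ?p]
        (mod int ?p ^ Suc (Suc k))"
      by (rule cong_power_prime_lift[rotated]) simp
    then have "padic_res (x ^ ?p) (Suc (Suc k)) = padic_res (y ^ ?p) (Suc (Suc k))"
      by (simp add: padic_res_power cong_def)
    then show ?case using x y by (simp add: pow)
  qed
  have "padic_res x 0 = padic_res y 0"
    using padic_res_bounds[of x 0] padic_res_bounds[of y 0] by simp
  then show "x = y"
    by (metis eq padic_int_eqI not0_implies_Suc)
qed

section \<open>McCarthy's p-adic hypergeometric series\<close>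

text \<open>\<open>omega_bar_pow j\<close> is the j-th power of the inverse Teichmueller character,
  extended by 0 at 0 for every j, in particular for \<open>j = 0\<close>.\<close>

definition omega_bar_pow :: "nat \<Rightarrow> 'p::prime_card mod_ring \<Rightarrow> 'p padic" where
  "omega_bar_pow j t = (if t = 0 then 0 else inverse (to_fract (teichmueller t)) ^ j)"

definition Gamma_p :: "rat \<Rightarrow> 'p::prime_card padic" where
  "Gamma_p r = to_fract (padic_gamma (padic_of_rat r))"

text \<open>
  The parameter lists \<open>a\<close> and \<open>b\<close> have the same length n and consist of rationals whose
  denominators are prime to p.
\<close>

definition hyper_G :: "rat list \<Rightarrow> rat list \<Rightarrow> 'p::prime_card mod_ring \<Rightarrow> 'p padic" where
  "hyper_G a b t = (let p = CARD('p); n = length a in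
     - 1 / of_nat (p - 1) *
     (\<Sum>j = 0..p - 2. (- 1) ^ (j * n) * omega_bar_pow j t *
       (\<Prod>i<n. (- of_nat p) powi
             (- \<lfloor>frac (a ! i) - of_nat j / of_nat (p - 1)\<rfloor>
              - \<lfloor>frac (- (b ! i)) + of_nat j / of_nat (p - 1)\<rfloor>) *
           (Gamma_p (frac (a ! i - of_nat j / of_nat (p - 1))) / Gamma_p (frac (a ! i))) *
           (Gamma_p (frac (- (b ! i) + of_nat j / of_nat (p - 1))) / Gamma_p (frac (- (b ! i)))))))"

end

theory Submission
  imports Defs
begin

text \<open>
  Both sides are sums over the powers \<open>\<omega>\<^sup>-\<^sup>j\<close> of the inverse Teichmueller character, and the
  identity holds term by term after the substitution \<open>j \<mapsto> (p-1)/2 - j\<close> modulo \<open>p - 1\<close>. On the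
  arguments, \<open>x = j/(p-1)\<close> becomes \<open>1/2 - x\<close> modulo 1. A factor with upper parameter \<open>a'\<close> on the right then
  involves the fractional part of \<open>a' - 1/2 + x\<close>, and one with lower parameter \<open>b'\<close> that of
  \<open>-b' + 1/2 - x\<close>. Shifting the parameters of the right-hand side by one half turns its upper
  parameters into the negated lower parameters of the left-hand side and vice versa, as multisets
  of fractional parts. Hence the gamma factors that depend on \<open>j\<close> agree. The exponent of \<open>-p\<close> is a sum
  of differences \<open>\<langle>a - x\<rangle> - \<langle>a\<rangle> + x\<close> and \<open>\<langle>-b + x\<rangle> - \<langle>-b\<rangle> - x\<close>, so it agrees as well once the total of the
  fractional parts of the parameters is the same on both sides (lemma \<open>hyper_term_reflect\<close>).

  What remains is a constant. The substitution multiplies the power of \<open>\<omega>\<close> by \<open>\<omega>\<close> to the power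
  \<open>(p-1)/2\<close>, the quadratic character \<open>\<phi>\<close>, which gives \<open>\<phi>(\<lambda>)\<close>, and it multiplies the sign \<open>(-1)\<^sup>j\<^sup>n\<close> by
  \<open>\<phi>(-1)\<^sup>n\<close>, where \<open>n = d - 1\<close> is the number of upper parameters
  (lemma \<open>hyper_G_reflect\<close>). The normalising gamma values in the denominators differ by a quotient
  that the multiplication formula evaluates: the product of \<open>\<Gamma>\<^sub>p((2h+1)/(2N))\<close> over \<open>h < N\<close> is \<open>\<phi>(N)\<close> times
  \<open>\<Gamma>\<^sub>p(1/2)\<close> times the product of \<open>\<Gamma>\<^sub>p(h/N)\<close> (theorem \<open>padic_gamma_multiplication_half\<close>), used with
  \<open>N = d - 1\<close> for even \<open>d\<close> and with \<open>N = d\<close> for odd \<open>d\<close>. The missing parameter on the right, whose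
  fractional part is one half, accounts for the factor \<open>\<Gamma>\<^sub>p(1/2)\<close>.

  The multiplication formula is proved by congruences modulo every \<open>p\<^sup>k\<close>. With \<open>u\<close> inverse to \<open>N\<close>, the
  product \<open>F(y)\<close> of the values \<open>\<Gamma>\<^sub>p((y+h)u)\<close> over \<open>h < N\<close> satisfies the same first-order recurrence in \<open>y\<close> as
  \<open>\<Gamma>\<^sub>p(y)\<close>, up to a factor \<open>1/N\<close> whenever \<open>y\<close> is prime to \<open>p\<close>. Evaluating at \<open>y = (p\<^sup>k+1)/2\<close>, which represents
  one half, the power of \<open>N\<close> that has accumulated is \<open>N\<close> to half of Euler's totient of \<open>p\<^sup>k\<close>, that is
  \<open>\<phi>(N)\<close> by Euler's criterion.
\<close>

section \<open>A multiplication formula for the p-adic gamma function\<close>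

lemma gamma_nat_0: "gamma_nat p 0 = 1"
  by (simp add: gamma_nat_altdef)

lemma gamma_nat_Suc:
  "gamma_nat p (Suc n) = - (if p dvd n then 1 else int n) * gamma_nat p n"
  by (simp add: gamma_nat_altdef)

lemma coprime_gamma_nat:
  assumes "prime p"
  shows "coprime (gamma_nat p n) (int p ^ k)"
  using assms prime_not_dvd_gamma_nat[OF assms, of n]
  by (simp add: coprime_commute prime_imp_coprime)

text \<open>
  Induction on \<open>y\<close>: passing from \<open>y\<close> to \<open>y + 1\<close> replaces the factor at \<open>yu\<close> of the product by one at
  \<open>(y + m)u \<equiv> yu + 1\<close>, and \<open>p\<close> divides \<open>yu\<close> exactly if it divides \<open>y\<close>. So both sides satisfy the
  functional equation of the gamma function; when \<open>p\<close> does not divide \<open>y\<close>, the factor is \<open>-yu\<close> on the left instead of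
  \<open>-y\<close>, and the power of \<open>m\<close> makes up for the \<open>u\<close>.
\<close>

lemma gamma_nat_multiplication_cong:
  fixes p m u k :: nat
  assumes p: "prime p" "odd p" and k: "k > 0" and u: "[m * u = 1] (mod p ^ k)"
  defines "F \<equiv> \<lambda>y. \<Prod>h<m. gamma_nat p ((y + h) * u)"
  shows "[F y * int m ^ card {i. i < y \<and> \<not> p dvd i} = F 0 * gamma_nat p y] (mod int p ^ k)"
proof (induction y)
  case 0
  show ?case by (simp add: gamma_nat_0)
next
  case (Suc y)
  let ?g = "gamma_nat p" and ?c = "\<lambda>y. card {i. i < y \<and> \<not> p dvd i}"
  define w where "w = (if p dvd y then 1 else int y)"
  define v where "v = (if p dvd y then 1 else int (y * u))"
  have "[m * u = 1] (mod p)"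
    using u by (rule cong_dvd_modulus_nat) (use k in simp)
  then have "p dvd m * u \<longleftrightarrow> p dvd 1" by (rule cong_dvd_iff)
  then have "\<not> p dvd u"
    using p(1) not_prime_unit by auto
  then have yu: "p dvd y * u \<longleftrightarrow> p dvd y"
    using p(1) by (auto simp: prime_dvd_mult_iff)
  have "F (Suc y) * ?g (y * u) = (\<Prod>h<Suc m. ?g ((y + h) * u))"
    unfolding F_def by (subst prod.lessThan_Suc_shift) simp
  then have shift: "F (Suc y) * ?g (y * u) = F y * ?g ((y + m) * u)"
    by (simp add: F_def)
  have "[?g ((y + m) * u) = ?g (Suc (y * u))] (mod int p ^ k)"
  proof (rule gamma_nat_cong[OF p])
    show "[(y + m) * u = Suc (y * u)] (mod p ^ k)"
      using cong_add[OF cong_refl[of "y * u"] u] by (simp add: algebra_simps)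
  qed
  also have "?g (Suc (y * u)) = - v * ?g (y * u)"
    by (simp add: gamma_nat_Suc yu v_def)
  finally have "[F (Suc y) * ?g (y * u) = F y * (- v * ?g (y * u))] (mod int p ^ k)"
    unfolding shift by (rule cong_scalar_left)
  then have "[F (Suc y) * ?g (y * u) = (- v * F y) * ?g (y * u)] (mod int p ^ k)"
    by (simp add: mult_ac)
  then have step: "[F (Suc y) = - v * F y] (mod int p ^ k)"
    by (rule cong_mult_rcancel[OF coprime_gamma_nat[OF p(1)], THEN iffD1])
  have c: "?c (Suc y) = ?c y + (if p dvd y then 0 else 1)"
  proof -
    have "{i. i < Suc y \<and> \<not> p dvd i} = {i. i < y \<and> \<not> p dvd i} \<union> (if p dvd y then {} else {y})"
      by (auto simp: less_Suc_eq)
    then show ?thesis by simp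
  qed
  have vm: "[v * int m ^ (if p dvd y then 0 else 1) = w] (mod int p ^ k)"
  proof -
    have "[int (m * u) = int 1] (mod int (p ^ k))" using u by (simp only: cong_int_iff)
    then have "[int y * int (m * u) = int y * 1] (mod int p ^ k)"
      by (intro cong_mult) auto
    then show ?thesis by (simp add: v_def w_def mult_ac)
  qed
  have "[F (Suc y) * int m ^ ?c (Suc y) = (- v * F y) * int m ^ ?c (Suc y)] (mod int p ^ k)"
    using step by (rule cong_scalar_right)
  also have "(- v * F y) * int m ^ ?c (Suc y)
      = - (v * int m ^ (if p dvd y then 0 else 1)) * (F y * int m ^ ?c y)"
    unfolding c power_add by simp
  also have "[\<dots> = - w * (F 0 * ?g y)] (mod int p ^ k)"
    by (rule cong_mult[OF _ Suc.IH]) (use vm in \<open>simp add: cong_minus_minus_iff\<close>)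
  also have "- w * (F 0 * ?g y) = F 0 * ?g (Suc y)"
    by (simp add: gamma_nat_Suc w_def)
  finally show ?case .
qed

text \<open>
  This is half of Euler's totient of \<open>p ^ Suc k\<close>: the accumulated exponent of \<open>m\<close> in
  \<open>gamma_nat_multiplication_cong\<close> at the integer that represents one half.
\<close>

lemma card_nonmultiples_below_half_prime_power:
  fixes p k :: nat
  assumes p: "prime p" "odd p"
  shows "card {i. i < (p ^ Suc k + 1) div 2 \<and> \<not> p dvd i} = (p - 1) div 2 * p ^ k"
proof -
  obtain s where s: "p = 2 * s + 1" using p by (elim oddE)
  have "odd (p ^ k)" using p by simp
  then obtain r where r: "p ^ k = 2 * r + 1" by (elim oddE)
  define y where "y = (p ^ Suc k + 1) div 2"
  have y: "y = p * r + s + 1" by (simp add: y_def r) (simp add: s algebra_simps)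
  have below: "p * t < y \<longleftrightarrow> t < r + 1" for t
  proof
    assume "t < r + 1"
    then have "p * t \<le> p * r" by simp
    then show "p * t < y" using y by linarith
  next
    assume less: "p * t < y"
    show "t < r + 1"
    proof (rule ccontr)
      assume "\<not> t < r + 1"
      then have "p * (r + 1) \<le> p * t" by (intro mult_left_mono) auto
      moreover have "p * (r + 1) = p * r + 2 * s + 1" using s by simp
      ultimately show False using less y by linarith
    qed
  qed
  have "{i. i < y \<and> p dvd i} = (\<lambda>t. p * t) ` {..<r + 1}" (is "?M = ?I")
  proof
    show "?M \<subseteq> ?I" using below unfolding dvd_def by blast
    show "?I \<subseteq> ?M" using below by (simp add: image_subset_iff)
  qed
  moreover have "inj_on (\<lambda>t. p * t) {..<r + 1}"
    using prime_gt_0_nat[OF p(1)] by (intro inj_onI) simp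
  ultimately have mult: "card {i. i < y \<and> p dvd i} = r + 1"
    by (simp only: card_image card_lessThan)
  have "{i. i < y \<and> \<not> p dvd i} = {..<y} - {i. i < y \<and> p dvd i}" by auto
  then have "card {i. i < y \<and> \<not> p dvd i} = y - (r + 1)"
    using mult by (simp add: card_Diff_subset subset_eq)
  also have "\<dots> = s * (2 * r + 1)" by (simp add: y s algebra_simps)
  also have "s = (p - 1) div 2" using s by simp
  finally show ?thesis by (simp only: y_def r)
qed

text \<open>
  Euler's criterion, lifted from \<open>p\<close> to its powers: raising to the power \<open>p\<close> improves a congruence by one
  power of \<open>p\<close>, and it fixes the values \<open>1\<close> and \<open>-1\<close>.
\<close>

lemma Legendre_cong_prime_power:
  fixes p :: nat
  assumes p: "prime p" "odd p" and a: "\<not> int p dvd a"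
  shows "[a ^ ((p - 1) div 2 * p ^ k) = Legendre a (int p)] (mod int p ^ Suc k)"
proof (induction k)
  case 0
  have "p > 2" using p prime_ge_2_nat[of p] by (cases "p = 2") auto
  then have "[Legendre a (int p) = a ^ ((p - 1) div 2)] (mod int p)"
    using p(1) by (intro euler_criterion)
  then show ?case by (simp add: cong_sym)
next
  case (Suc k)
  have "p > 0" using p prime_gt_0_nat by blast
  then have "[(a ^ ((p - 1) div 2 * p ^ k)) ^ p = Legendre a (int p) ^ p] (mod int p ^ Suc (Suc k))"
    using Suc by (rule cong_power_prime_lift)
  moreover have "Legendre a (int p) ^ p = Legendre a (int p)"
    using p \<open>p > 0\<close> by (auto simp: Legendre_def power_0_left)
  moreover have "a ^ ((p - 1) div 2 * p ^ Suc k) = (a ^ ((p - 1) div 2 * p ^ k)) ^ p"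
    by (simp only: power_mult power_Suc2)
  ultimately show ?case by (simp only:)
qed

lemma padic_gamma_spec:
  assumes odd: "odd CARD('p::prime_card)"
  shows "padic_gamma x dvd (1 :: 'p padic_int)"
    and "continuous_on UNIV (padic_gamma :: 'p padic_int \<Rightarrow> 'p padic_int)"
    and "padic_gamma (0 :: 'p padic_int) = 1"
    and "n > 0 \<Longrightarrow> padic_gamma (of_nat n :: 'p padic_int) = of_int (gamma_nat CARD('p) n)"
  using theI'[OF ex1_padic_gamma[OF odd], folded padic_gamma_def]
  by (auto simp: gamma_nat_def)

text \<open>
  Approximate \<open>x\<close> by natural numbers that agree with it to a precision so high that continuity fixes the gamma
  value modulo \<open>p ^ k\<close>; the value at such a number depends only on its residue modulo \<open>p ^ k\<close>.
\<close>

lemma padic_res_gamma: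
  fixes x :: "'p::prime_card padic_int"
  assumes odd: "odd CARD('p)" and n: "[int n = padic_res x k] (mod int CARD('p) ^ k)"
  shows "padic_res (padic_gamma x) k = gamma_nat CARD('p) n mod int CARD('p) ^ k"
proof -
  let ?p = "CARD('p)" and ?G = "padic_gamma :: 'p padic_int \<Rightarrow> 'p padic_int"
  have p: "prime ?p" by (rule prime_card)
  have c: "real ?p > 1" using prime_gt_1_nat[OF p] by simp
  have "1 / real ?p ^ k > 0" using c by simp
  then obtain \<delta> where \<delta>: "\<delta> > 0"
    and cont: "\<And>y. dist y x < \<delta> \<Longrightarrow> dist (?G y) (?G x) < 1 / real ?p ^ k"
  proof -
    have "(?G \<longlongrightarrow> ?G x) (at x)"
      using padic_gamma_spec(2)[OF odd] by (simp add: continuous_on_def)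
    then have "\<forall>\<^sub>F y in at x. dist (?G y) (?G x) < 1 / real ?p ^ k"
      using \<open>1 / real ?p ^ k > 0\<close> by (rule tendstoD)
    then obtain \<delta> where "\<delta> > 0"
      and "\<And>y. y \<noteq> x \<Longrightarrow> dist y x < \<delta> \<Longrightarrow> dist (?G y) (?G x) < 1 / real ?p ^ k"
      unfolding eventually_at by auto
    moreover have "dist (?G x) (?G x) < 1 / real ?p ^ k"
      using \<open>1 / real ?p ^ k > 0\<close> by simp
    ultimately have "dist (?G y) (?G x) < 1 / real ?p ^ k" if "dist y x < \<delta>" for y
      using that by (cases "y = x") simp_all
    then show ?thesis using that \<open>\<delta> > 0\<close> by blast
  qed
  obtain l where l: "(1 / real ?p) ^ l < \<delta>"
    using real_arch_pow_inv[OF \<delta>, of "1 / real ?p"] c by (auto simp: divide_less_eq)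
  define m where "m = max k l"
  \<comment> \<open>Adding \<open>p ^ m\<close> keeps \<open>N\<close> positive, where the product formula for the gamma value applies.\<close>
  define N where "N = nat (padic_res x m) + ?p ^ m"
  have N: "padic_res (of_nat N :: 'p padic_int) m = padic_res x m"
    unfolding N_def padic_res_of_nat by (simp add: padic_res_bounds)
  then have "dist (of_nat N) x \<le> 1 / real ?p ^ m" by (simp only: dist_padic_int_le_iff)
  also have "\<dots> \<le> (1 / real ?p) ^ l"
    using c by (simp add: m_def power_one_over frac_le)
  finally have "dist (of_nat N) x < \<delta>" using l by linarith
  then have "dist (?G (of_nat N)) (?G x) \<le> 1 / real ?p ^ k"
    by (rule cont [THEN less_imp_le])
  then have "padic_res (?G x) k = padic_res (?G (of_nat N)) k"
    by (simp only: dist_padic_int_le_iff)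
  also have "?G (of_nat N) = of_int (gamma_nat ?p N)"
    by (rule padic_gamma_spec(4)[OF odd]) (simp add: N_def)
  also have "padic_res (of_int (gamma_nat ?p N) :: 'p padic_int) k = gamma_nat ?p N mod int ?p ^ k"
    by (rule padic_res_of_int)
  also have "\<dots> = gamma_nat ?p n mod int ?p ^ k"
  proof -
    have "padic_res (of_nat N :: 'p padic_int) k = padic_res x k"
      using padic_res_mod[of k m "of_nat N :: 'p padic_int"] padic_res_mod[of k m x] N by (simp add: m_def)
    then have "[int N = padic_res x k] (mod int ?p ^ k)"
      by (simp add: padic_res_of_nat cong_def)
    then have "[int N = int n] (mod int (?p ^ k))"
      using n unfolding of_nat_power by (metis cong_sym cong_trans)
    then have "[N = n] (mod ?p ^ k)" by (simp only: cong_int_iff)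
    then have "[gamma_nat ?p N = gamma_nat ?p n] (mod int ?p ^ k)"
      by (rule gamma_nat_cong[OF p odd])
    then show ?thesis by (simp only: cong_def)
  qed
  finally show ?thesis .
qed

lemma padic_of_rat_mult:
  assumes b: "\<not> CARD('p) dvd b"
  shows "of_nat b * padic_of_rat (of_nat a / of_nat b) = (of_nat a :: 'p::prime_card padic_int)"
proof -
  define r :: rat where "r = of_nat a / of_nat b"
  obtain s t where st: "quotient_of r = (s, t)" by force
  have t0: "t > 0" and r: "r = of_int s / of_int t" and cop: "coprime s t"
    using st quotient_of_denom_pos quotient_of_div quotient_of_coprime by blast+
  have b0: "b > 0" using b by (cases b) auto
  have "(of_int (s * int b) :: rat) = of_int (int a * t)"
    using r t0 b0 by (simp add: r_def field_simps)
  then have eq: "s * int b = int a * t" by (simp only: of_int_eq_iff)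
  then have "t dvd s * int b" by simp
  then have "t dvd int b" using cop by (simp add: coprime_commute coprime_dvd_mult_right_iff)
  then have "\<not> int CARD('p) dvd t"
    using b by (metis dvd_trans int_dvd_int_iff)
  then have "\<exists>!x :: 'p padic_int. of_int (snd (quotient_of r)) * x = of_int (fst (quotient_of r))"
    by (intro ex1_padic_of_rat) (simp add: st)
  from theI'[OF this] have x: "of_int t * padic_of_rat r = (of_int s :: 'p padic_int)"
    by (simp add: padic_of_rat_def st)
  have "of_int t * (of_nat b * padic_of_rat r) = of_nat b * (of_int s :: 'p padic_int)"
    by (simp add: x[symmetric])
  also have "\<dots> = of_int t * of_nat a"
    using arg_cong[OF eq, of "of_int :: int \<Rightarrow> 'p padic_int"] by (simp add: mult.commute)
  finally show ?thesis using t0 by (simp add: r_def)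
qed

lemma padic_res_gamma_rat:
  fixes a b n k :: nat
  assumes odd: "odd CARD('p::prime_card)" and b: "\<not> CARD('p) dvd b"
    and n: "[b * n = a] (mod CARD('p) ^ k)"
  shows "padic_res (padic_gamma (padic_of_rat (of_nat a / of_nat b)) :: 'p padic_int) k
    = gamma_nat CARD('p) n mod int CARD('p) ^ k"
proof (rule padic_res_gamma[OF odd])
  let ?p = "CARD('p)"
  define x :: "'p padic_int" where "x = padic_of_rat (of_nat a / of_nat b)"
  have "of_nat b * x = of_nat a" unfolding x_def by (rule padic_of_rat_mult[OF b])
  then have "padic_res (of_nat b * x) k = padic_res (of_nat a :: 'p padic_int) k" by simp
  then have "[int b * padic_res x k = int a] (mod int ?p ^ k)"
    by (simp add: padic_res_simps padic_res_of_nat cong_def mod_simps)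
  moreover have "[int (b * n) = int a] (mod int (?p ^ k))"
    using n by (simp only: cong_int_iff)
  ultimately have "[int b * int n = int b * padic_res x k] (mod int ?p ^ k)"
    by (simp add: cong_def)
  moreover have "coprime (int b) (int ?p ^ k)"
    using prime_imp_coprime[OF prime_card[where 'a='p] b] by (simp add: coprime_commute)
  ultimately show "[int n = padic_res (padic_of_rat (of_nat a / of_nat b) :: 'p padic_int) k]
      (mod int ?p ^ k)"
    by (simp add: cong_mult_lcancel x_def)
qed

lemma padic_res_prod:
  "padic_res (\<Prod>i\<in>I. f i :: 'p::prime_card padic_int) k
    = (\<Prod>i\<in>I. padic_res (f i) k) mod int CARD('p) ^ k"
  by (induction I rule: infinite_finite_induct) (simp_all add: padic_res_simps mod_simps)

text \<open>
  The Gross--Koblitz multiplication formula at the argument one half. Modulo \<open>p ^ k\<close>, with \<open>u\<close> inverse to \<open>m\<close>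
  and \<open>y = (p ^ k + 1) / 2\<close>, the rationals \<open>(2h+1)/(2m)\<close>, \<open>h/m\<close> and \<open>1/2\<close> are represented by \<open>(y + h)u\<close>, \<open>hu\<close> and \<open>y\<close>.
\<close>

theorem padic_gamma_multiplication_half:
  fixes m :: nat
  defines "G \<equiv> \<lambda>a b. padic_gamma (padic_of_rat (of_nat a / of_nat b)) :: 'p::prime_card padic_int"
  assumes odd: "odd CARD('p)" and m: "\<not> CARD('p) dvd m"
  shows "(\<Prod>h<m. G (2 * h + 1) (2 * m)) * of_int (Legendre (int m) (int CARD('p)))
    = (\<Prod>h<m. G h m) * G 1 2"
proof (rule padic_int_eqI)
  fix k
  let ?p = "CARD('p)" and ?g = "gamma_nat CARD('p)"
  have p: "prime ?p" by (rule prime_card)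
  have "\<not> ?p dvd 2" using p odd by (metis primes_dvd_imp_eq two_is_prime_nat even_numeral)
  then have m2: "\<not> ?p dvd 2 * m" using m p by (simp add: prime_dvd_mult_iff)
  show "padic_res ((\<Prod>h<m. G (2 * h + 1) (2 * m)) * of_int (Legendre (int m) (int ?p))) k
    = padic_res ((\<Prod>h<m. G h m) * G 1 2) k"
  proof (cases k)
    case 0
    then show ?thesis by (simp add: padic_res_simps)
  next
    case (Suc l)
    \<comment> \<open>\<open>y\<close> represents one half modulo \<open>p ^ k\<close>.\<close>
    define y where "y = (?p ^ k + 1) div 2"
    have y: "2 * y = ?p ^ k + 1" using odd by (simp add: y_def)
    have "coprime m (?p ^ k)"
      using prime_imp_coprime[OF p m] by (simp add: coprime_commute)
    then obtain u where u: "[m * u = 1] (mod ?p ^ k)"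
      using cong_solve_coprime_nat[of m "?p ^ k"] by (auto simp del: coprime_power_right_iff)
    have "padic_res (G (2 * h + 1) (2 * m)) k = ?g ((y + h) * u) mod int ?p ^ k" for h
      unfolding G_def
    proof (rule padic_res_gamma_rat[OF odd m2])
      have "2 * m * ((y + h) * u) = (2 * y + 2 * h) * (m * u)" by (simp add: algebra_simps)
      also have "[\<dots> = (2 * y + 2 * h) * 1] (mod ?p ^ k)" using u by (intro cong_mult) auto
      also have "(2 * y + 2 * h) * 1 = (2 * h + 1) + ?p ^ k" unfolding y by simp
      also have "[\<dots> = 2 * h + 1] (mod ?p ^ k)" unfolding cong_def by (rule mod_add_self2)
      finally show "[2 * m * ((y + h) * u) = 2 * h + 1] (mod ?p ^ k)" .
    qed
    moreover have "padic_res (G h m) k = ?g ((0 + h) * u) mod int ?p ^ k" for h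
      unfolding G_def
    proof (rule padic_res_gamma_rat[OF odd m])
      show "[m * ((0 + h) * u) = h] (mod ?p ^ k)"
        using cong_mult[OF cong_refl[of h] u] by (simp add: mult_ac)
    qed
    moreover have "padic_res (G 1 2) k = ?g y mod int ?p ^ k"
      unfolding G_def
      by (rule padic_res_gamma_rat[OF odd \<open>\<not> ?p dvd 2\<close>])
        (simp only: y cong_def mod_add_self1)
    moreover have "[(\<Prod>h<m. ?g ((y + h) * u)) * Legendre (int m) (int ?p)
        = (\<Prod>h<m. ?g ((0 + h) * u)) * ?g y] (mod int ?p ^ k)"
    proof -
      have "[int m ^ card {i. i < y \<and> \<not> ?p dvd i} = Legendre (int m) (int ?p)] (mod int ?p ^ k)"
        using Legendre_cong_prime_power[OF p odd, of "int m" l] m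
        by (simp add: y_def Suc card_nonmultiples_below_half_prime_power[OF p odd, simplified])
      then have "[(\<Prod>h<m. ?g ((y + h) * u)) * Legendre (int m) (int ?p)
          = (\<Prod>h<m. ?g ((y + h) * u)) * int m ^ card {i. i < y \<and> \<not> ?p dvd i}] (mod int ?p ^ k)"
        by (intro cong_scalar_left) (rule cong_sym)
      then show ?thesis
        by (rule cong_trans) (rule gamma_nat_multiplication_cong[OF p odd _ u], simp add: Suc)
    qed
    moreover have "(\<Prod>h<m. f h mod q) * c mod q = (\<Prod>h<m. f h) * c mod q" for f c and q :: int
      by (metis mod_mult_left_eq mod_prod_eq)
    ultimately show ?thesis
      by (simp only: padic_res_simps padic_res_prod padic_res_of_int cong_def mod_simps)
  qed
qed

section \<open>The Teichmueller character and the quadratic character\<close>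

lemma padic_res_1_eq: "padic_res x 1 = to_int_mod_ring (padic_reduce x)"
  using padic_res_bounds[of x 1] by (simp add: padic_reduce_def of_int_of_int_mod_ring)

lemma padic_reduce_mult: "padic_reduce (x * y) = padic_reduce x * padic_reduce y"
proof -
  have "padic_res (x * y) 1 = padic_res x 1 * padic_res y 1 mod int CARD('a)"
    by (simp add: padic_res_simps)
  moreover have "of_int (z mod int CARD('a)) = (of_int z :: 'a mod_ring)" for z
    using of_int_mod_CHAR[of z, where 'a = "'a mod_ring"] by simp
  ultimately show ?thesis by (simp add: padic_reduce_def)
qed

lemma teichmueller_spec:
  fixes a :: "'p::prime_card mod_ring"
  assumes "a \<noteq> 0"
  shows "teichmueller a ^ (CARD('p) - Suc 0) = 1" and "padic_reduce (teichmueller a) = a"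
  using theI'[OF ex1_teichmueller[OF assms], folded teichmueller_def] by auto

lemma teichmueller_unique:
  fixes a :: "'p::prime_card mod_ring"
  assumes "a \<noteq> 0" "x ^ (CARD('p) - 1) = 1" "padic_reduce x = a"
  shows "teichmueller a = x"
  unfolding teichmueller_def
  by (rule the1_equality[OF ex1_teichmueller[OF assms(1)]]) (use assms in simp)

lemma teichmueller_mult:
  fixes a b :: "'p::prime_card mod_ring"
  assumes "a \<noteq> 0" "b \<noteq> 0"
  shows "teichmueller (a * b) = teichmueller a * teichmueller b"
  using assms
  by (intro teichmueller_unique) (simp_all add: power_mult_distrib teichmueller_spec padic_reduce_mult)

lemma padic_reduce_1: "padic_reduce 1 = 1"
  by (simp add: padic_reduce_def padic_res_simps)

lemma teichmueller_1: "teichmueller (1 :: 'p::prime_card mod_ring) = 1"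
  by (rule teichmueller_unique) (simp_all add: padic_reduce_1)

lemma teichmueller_minus_1:
  assumes "odd CARD('p)"
  shows "teichmueller (- 1 :: 'p::prime_card mod_ring) = - 1"
proof (rule teichmueller_unique)
  have "(padic_reduce (- 1) + 1 :: 'p mod_ring) = of_int (- 1 mod int CARD('p) + 1)"
    by (simp add: padic_reduce_def padic_res_simps)
  also have "- 1 mod int CARD('p) = int CARD('p) - 1"
    by (simp add: zmod_minus1)
  finally show "padic_reduce (- 1) = (- 1 :: 'p mod_ring)"
    by (simp add: eq_neg_iff_add_eq_0)
qed (use assms in simp_all)

lemma sign_eq_if_cong_odd:
  assumes "x \<in> {1, - 1 :: int}" "y \<in> {1, - 1}" "[x = y] (mod int n)" "n > 2"
  shows "x = y"
proof (rule ccontr)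
  assume "x \<noteq> y"
  then have "x - y = 2 \<or> x - y = - 2" using assms by auto
  moreover have "int n dvd x - y" using assms by (simp add: cong_iff_dvd_diff)
  ultimately have "int n dvd 2" by auto
  then show False using assms(4) zdvd_imp_le by fastforce
qed

text \<open>
  The left-hand side is a square root of 1, hence a sign, and it reduces modulo \<open>p\<close> to \<open>a ^ ((p - 1) / 2)\<close>.
  By Euler's criterion that is the Legendre symbol, and two signs that agree modulo an odd prime are equal.
\<close>

lemma teichmueller_half_power:
  fixes a :: "'p::prime_card mod_ring"
  assumes odd: "odd CARD('p)" and a: "a \<noteq> 0"
  shows "teichmueller a ^ ((CARD('p) - 1) div 2) = of_int (quad_char a)"
proof -
  let ?p = "CARD('p)" and ?r = "to_int_mod_ring a"
  let ?h = "(?p - 1) div 2"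
  define x where "x = teichmueller a ^ ?h"
  have p: "prime ?p" by (rule prime_card)
  have p2: "?p > 2" using odd prime_ge_2_nat[OF p] by (cases "?p = 2") auto
  have "even (?p - 1)" using odd by simp
  then have "x\<^sup>2 = 1"
    unfolding x_def power_mult[symmetric] by (simp add: teichmueller_spec[OF a])
  then have "x = 1 \<or> x = - 1" by (simp add: power2_eq_1_iff)
  then obtain s :: int where s: "s \<in> {1, - 1}" and x: "x = of_int s"
  proof
    assume "x = 1"
    then show ?thesis using that[of 1] by simp
  next
    assume "x = - 1"
    then show ?thesis using that[of "- 1"] by simp
  qed
  have r: "[?r \<noteq> 0] (mod int ?p)"
  proof
    assume "[?r = 0] (mod int ?p)"
    moreover have "?r \<in> {0..<int ?p}"
      unfolding range_to_int_mod_ring[symmetric] by simp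
    ultimately have "?r = 0" by (simp add: cong_def)
    then show False using a by simp
  qed
  have "padic_res x 1 = ?r ^ ?h mod int ?p"
    using padic_res_1_eq[of "teichmueller a"]
    by (simp add: x_def padic_res_power teichmueller_spec[OF a])
  then have "[s = ?r ^ ?h] (mod int ?p)"
    by (simp add: x padic_res_of_int cong_def)
  moreover have "[Legendre ?r (int ?p) = ?r ^ ?h] (mod int ?p)"
    using p p2 by (rule euler_criterion)
  ultimately have "[s = quad_char a] (mod int ?p)"
    unfolding quad_char_def by (meson cong_sym cong_trans)
  moreover have "quad_char a \<in> {1, - 1}"
    using r by (simp add: quad_char_def Legendre_def)
  ultimately have "s = quad_char a"
    using s p2 by (intro sign_eq_if_cong_odd)
  then show ?thesis using x by (simp add: x_def)
qed

lemma to_fract_power: "to_fract (x ^ n) = to_fract x ^ n"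
  by (induction n) simp_all

lemma to_fract_of_nat: "to_fract (of_nat n) = of_nat n"
  by (induction n) simp_all

lemma to_fract_of_int: "to_fract (of_int n) = of_int n"
  by (cases n rule: int_diff_cases) (simp add: to_fract_of_nat)

lemma of_nat_CARD_padic_nonzero: "(of_nat CARD('p::prime_card) :: 'p padic) \<noteq> 0"
proof -
  have "(of_nat CARD('p) :: 'p padic_int) \<noteq> 0" by simp
  then show ?thesis by (simp only: to_fract_of_nat[symmetric] to_fract_eq_0_iff not_False_eq_True)
qed

text \<open>
  Inherited from the multiplicativity of the Teichmueller character.
\<close>

lemma quad_char_mult:
  fixes a b :: "'p::prime_card mod_ring"
  assumes odd: "odd CARD('p)" and "a \<noteq> 0" "b \<noteq> 0"
  shows "quad_char (a * b) = quad_char a * quad_char b"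
proof -
  have "(of_int (quad_char (a * b)) :: 'p padic_int) = of_int (quad_char a * quad_char b)"
    using assms by (simp add: teichmueller_half_power[symmetric] teichmueller_mult power_mult_distrib)
  then show ?thesis by (simp only: of_int_eq_iff)
qed

lemma quad_char_minus_1:
  assumes odd: "odd CARD('p)"
  shows "quad_char (- 1 :: 'p::prime_card mod_ring) = (- 1) ^ ((CARD('p) - 1) div 2)"
proof -
  have "(of_int (quad_char (- 1 :: 'p mod_ring)) :: 'p padic_int)
      = of_int ((- 1) ^ ((CARD('p) - 1) div 2))"
    using teichmueller_half_power[OF odd, of "- 1"] by (simp add: teichmueller_minus_1[OF odd])
  then show ?thesis by (simp only: of_int_eq_iff)
qed

lemma quad_char_of_nat:
  "quad_char (of_nat n :: 'p::prime_card mod_ring) = Legendre (int n) (int CARD('p))"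
proof -
  have "to_int_mod_ring (of_nat n :: 'p mod_ring) = int n mod int CARD('p)"
    by (simp add: of_nat_of_int_mod_ring of_int_mod_ring.rep_eq to_int_mod_ring.rep_eq)
  then show ?thesis
    by (simp add: quad_char_def Legendre_def QuadRes_def cong_def)
qed

text \<open>
  Since \<open>\<omega>\<close> has order dividing \<open>p - 1\<close>, the character \<open>\<omega>\<close> to the power \<open>-j\<close> is \<open>\<omega>\<close> to the power \<open>(p - 1)/2 + k\<close>, and the
  power \<open>(p - 1)/2\<close> contributes the quadratic character.
\<close>

lemma omega_bar_pow_reflect:
  fixes a :: "'p::prime_card mod_ring"
  assumes odd: "odd CARD('p)" and a: "a \<noteq> 0"
    and jk: "[j + k = (CARD('p) - 1) div 2] (mod CARD('p) - 1)"
  shows "omega_bar_pow j a = of_int (quad_char a) * omega_bar_pow k (1 / a)"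
proof -
  let ?p = "CARD('p)"
  let ?h = "(?p - 1) div 2"
  define T where "T = to_fract (teichmueller a)"
  have T1: "T ^ (?p - 1) = 1"
    by (simp add: T_def to_fract_power[symmetric] teichmueller_spec[OF a])
  have "?p - 1 > 0" using prime_gt_1_nat[OF prime_card[where 'a='p]] by simp
  then have T0: "T \<noteq> 0" using T1 by (auto simp: zero_power)
  have Th: "T ^ ?h = of_int (quad_char a)"
    by (simp only: T_def to_fract_power[symmetric] teichmueller_half_power[OF odd a] to_fract_of_int)
  have hh: "?h + ?h = ?p - 1" using odd by presburger
  have "to_fract (teichmueller (1 / a)) * T = to_fract (teichmueller (1 / a * a))"
    unfolding T_def to_fract_mult[symmetric] using a by (subst teichmueller_mult) simp_all
  then have "to_fract (teichmueller (1 / a)) * T = 1"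
    using a by (simp add: teichmueller_1)
  then have inv: "to_fract (teichmueller (1 / a)) = inverse T"
    using T0 by (simp add: field_simps)
  have pow_mod: "T ^ n = T ^ (n mod (?p - 1))" for n
  proof -
    have "T ^ n = T ^ ((?p - 1) * (n div (?p - 1)) + n mod (?p - 1))" by simp
    then show ?thesis by (simp only: power_add power_mult T1) simp
  qed
  have "T ^ (j + k) = T ^ ?h"
    using pow_mod[of "j + k"] pow_mod[of ?h] jk by (simp only: cong_def)
  then have "T ^ j * (T ^ ?h * T ^ k) = T ^ (?h + ?h)"
    by (simp add: power_add mult_ac)
  also have "\<dots> = 1" by (simp only: hh T1)
  finally have "inverse T ^ j = T ^ ?h * T ^ k"
    using T0 by (simp add: field_simps)
  then have "inverse T ^ j = of_int (quad_char a) * T ^ k" by (simp only: Th)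
  then show ?thesis
    using a by (simp add: omega_bar_pow_def inv T_def[symmetric])
qed

section \<open>Reflecting a hypergeometric series\<close>

lemma frac_frac_diff: "frac (frac r - x) = frac (r - x :: rat)"
  by (simp only: diff_conv_add_uminus frac_add_simps)

lemma prod_nth_conv_prod_mset:
  fixes f :: "'a \<Rightarrow> 'b::comm_monoid_mult"
  shows "(\<Prod>i<length xs. f (xs ! i)) = (\<Prod>x\<in>#mset xs. f x)"
proof -
  have "(\<Prod>x\<in>#mset xs. f x) = prod_list (map f xs)"
    by (simp only: mset_map[symmetric] prod_mset_prod_list)
  also have "\<dots> = (\<Prod>i<length xs. f (xs ! i))"
    by (simp add: prod.list_conv_set_nth atLeast0LessThan)
  finally show ?thesis ..
qed

lemma sum_nth_conv_sum_mset:
  fixes f :: "'a \<Rightarrow> 'b::comm_monoid_add"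
  shows "(\<Sum>i<length xs. f (xs ! i)) = (\<Sum>x\<in>#mset xs. f x)"
proof -
  have "(\<Sum>x\<in>#mset xs. f x) = sum_list (map f xs)"
    by (simp only: mset_map[symmetric] sum_mset_sum_list)
  also have "\<dots> = (\<Sum>i<length xs. f (xs ! i))"
    by (simp add: sum.list_conv_set_nth atLeast0LessThan)
  finally show ?thesis ..
qed

lemma prod_power_int:
  fixes x :: "'a::field"
  assumes "x \<noteq> 0"
  shows "(\<Prod>i\<in>I. x powi e i) = x powi (\<Sum>i\<in>I. e i)"
  by (induction I rule: infinite_finite_induct) (simp_all add: power_int_add assms)

text \<open>
  The \<open>j\<close>-th product in the series, at \<open>x = j/(p-1)\<close>, as a function of the multisets \<open>A\<close> of fractional parts
  of the upper parameters and \<open>B\<close> of fractional parts of the negated lower parameters. The exponents of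
  \<open>-p\<close> of the single factors are collected into one: the floors in the series are differences of
  fractional parts, and the multiples of \<open>x\<close> cancel between \<open>A\<close> and \<open>B\<close> if these have the same size.
  The floor below is then taken of an integer; it converts from the rationals to the integers.
\<close>

definition hyper_term :: "rat multiset \<Rightarrow> rat multiset \<Rightarrow> rat \<Rightarrow> 'p::prime_card padic" where
  "hyper_term A B x =
     (- of_nat CARD('p)) powi
       \<lfloor>(\<Sum>z\<in>#A. frac (z - x)) + (\<Sum>z\<in>#B. frac (z + x)) - (\<Sum>\<^sub># A + \<Sum>\<^sub># B)\<rfloor> *
     ((\<Prod>z\<in>#A. Gamma_p (frac (z - x))) * (\<Prod>z\<in>#B. Gamma_p (frac (z + x)))) /
     ((\<Prod>z\<in>#A. Gamma_p z) * (\<Prod>z\<in>#B. Gamma_p z))"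

lemma hyper_G_conv_hyper_term:
  fixes t :: "'p::prime_card mod_ring"
  assumes len: "length b = length a"
  shows "hyper_G a b t = - 1 / of_nat (CARD('p) - 1) *
    (\<Sum>j = 0..CARD('p) - 2. (- 1) ^ (j * length a) * omega_bar_pow j t *
       hyper_term (mset (map frac a)) (mset (map (\<lambda>r. frac (- r)) b))
         (of_nat j / of_nat (CARD('p) - 1)))"
proof -
  let ?P = "- of_nat CARD('p) :: 'p padic"
  let ?A = "mset (map frac a)" and ?B = "mset (map (\<lambda>r. frac (- r)) b)"
  have "(\<Prod>i<length a. ?P powi (- \<lfloor>frac (a ! i) - x\<rfloor> - \<lfloor>frac (- (b ! i)) + x\<rfloor>) *
           (Gamma_p (frac (a ! i - x)) / Gamma_p (frac (a ! i))) *
           (Gamma_p (frac (- (b ! i) + x)) / Gamma_p (frac (- (b ! i)))))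
      = hyper_term ?A ?B x" for x
  proof -
    define e where "e i = - \<lfloor>frac (a ! i) - x\<rfloor> - \<lfloor>frac (- (b ! i)) + x\<rfloor>" for i
    have a: "(\<Prod>i<length a. f (a ! i)) = (\<Prod>r\<in>#mset a. f r)" for f :: "rat \<Rightarrow> 'p padic"
      by (rule prod_nth_conv_prod_mset)
    have b: "(\<Prod>i<length a. f (b ! i)) = (\<Prod>r\<in>#mset b. f r)" for f :: "rat \<Rightarrow> 'p padic"
      unfolding len[symmetric] by (rule prod_nth_conv_prod_mset)
    have a': "(\<Sum>i<length a. f (a ! i)) = (\<Sum>r\<in>#mset a. f r)" for f :: "rat \<Rightarrow> rat"
      by (rule sum_nth_conv_sum_mset)
    have b': "(\<Sum>i<length a. f (b ! i)) = (\<Sum>r\<in>#mset b. f r)" for f :: "rat \<Rightarrow> rat"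
      unfolding len[symmetric] by (rule sum_nth_conv_sum_mset)
    have floor: "- of_int \<lfloor>frac r - x\<rfloor> = frac (r - x) - frac r + x"
        "- of_int \<lfloor>frac r + x\<rfloor> = frac (r + x) - frac r - x" for r :: rat
      using frac_def[of "frac r - x"] frac_def[of "frac r + x"] by (simp_all add: frac_frac_diff)
    have e_eq: "of_int (e i) = frac (a ! i - x) + frac (- (b ! i) + x)
        - (frac (a ! i) + frac (- (b ! i)))" for i
      unfolding e_def of_int_diff of_int_minus
      using floor(1)[of "a ! i"] floor(2)[of "- (b ! i)"] by linarith
    have "of_int (\<Sum>i<length a. e i)
        = (\<Sum>z\<in>#?A. frac (z - x)) + (\<Sum>z\<in>#?B. frac (z + x)) - (\<Sum>\<^sub># ?A + \<Sum>\<^sub># ?B)"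
      by (simp add: e_eq sum.distrib sum_subtractf a'[of "\<lambda>r. frac (r - x)"] a'[of frac] b'[of "\<lambda>r. frac (- r + x)"]
          b'[of "\<lambda>r. frac (x - r)"] b'[of "\<lambda>r. frac (- r)"] multiset.map_comp o_def frac_frac_diff)
    then have "(\<Sum>i<length a. e i)
        = \<lfloor>(\<Sum>z\<in>#?A. frac (z - x)) + (\<Sum>z\<in>#?B. frac (z + x)) - (\<Sum>\<^sub># ?A + \<Sum>\<^sub># ?B)\<rfloor>"
      by (metis floor_of_int)
    moreover have "(\<Prod>i<length a. ?P powi e i) = ?P powi (\<Sum>i<length a. e i)"
      by (rule prod_power_int) (simp add: of_nat_CARD_padic_nonzero)
    ultimately show ?thesis
      unfolding hyper_term_def e_def[symmetric] prod.distrib prod_dividef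
      by (simp add: a[of "\<lambda>r. Gamma_p (frac (r - x))"] a[of "\<lambda>r. Gamma_p (frac r)"]
          b[of "\<lambda>r. Gamma_p (frac (- r + x))"] b[of "\<lambda>r. Gamma_p (frac (x - r))"]
          b[of "\<lambda>r. Gamma_p (frac (- r))"] multiset.map_comp o_def frac_frac_diff)
  qed
  then show ?thesis
    by (simp only: hyper_G_def Let_def)
qed

lemma Gamma_p_nonzero:
  assumes "odd CARD('p)"
  shows "Gamma_p r \<noteq> (0 :: 'p::prime_card padic)"
proof -
  have "padic_gamma (padic_of_rat r) \<noteq> (0 :: 'p padic_int)"
    using padic_gamma_spec(1)[OF assms] by (metis dvd_0_left zero_neq_one)
  then show ?thesis by (simp add: Gamma_p_def)
qed

text \<open>
  A shift by one half exchanges the roles of \<open>A\<close> and \<open>B\<close>, because \<open>x\<close> and \<open>y\<close> add up to one half modulo 1: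
  the part that depends on \<open>x\<close> is the same on both sides, and only the normalising denominators differ.
\<close>

lemma hyper_term_reflect:
  fixes C :: "'p::prime_card padic"
  assumes odd: "odd CARD('p)"
    and A: "image_mset (\<lambda>z. frac (z + 1/2)) B' = A"
    and B: "image_mset (\<lambda>z. frac (z + 1/2)) A' = B"
    and sum: "\<Sum>\<^sub># A' + \<Sum>\<^sub># B' = \<Sum>\<^sub># A + \<Sum>\<^sub># B"
    and gamma: "(\<Prod>z\<in>#A'. Gamma_p z) * (\<Prod>z\<in>#B'. Gamma_p z)
      = C * ((\<Prod>z\<in>#A. Gamma_p z) * (\<Prod>z\<in>#B. Gamma_p z))"
    and xy: "x + y - 1/2 \<in> \<int>"
  shows "hyper_term A B x = C * hyper_term A' B' y"
proof -
  obtain n where n: "x + y - 1/2 = of_int n" using xy by (elim Ints_cases)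
  have up: "frac (frac (z + 1/2) + x) = frac (z - y)" for z
  proof -
    have "frac (frac (z + 1/2) + x) = frac ((z - y) + of_int (n + 1))"
      unfolding of_int_add n[symmetric] frac_add_simps by (simp add: algebra_simps)
    then show ?thesis by (simp only: frac_add_of_int_right)
  qed
  have low: "frac (frac (z + 1/2) - x) = frac (z + y)" for z
  proof -
    have "frac (frac (z + 1/2) - x) = frac ((z + y) + of_int (- n))"
      unfolding of_int_minus n[symmetric] frac_frac_diff by (simp add: algebra_simps)
    then show ?thesis by (simp only: frac_add_of_int_right)
  qed
  have num: "(\<Prod>z\<in>#A. Gamma_p (frac (z - x))) = (\<Prod>z\<in>#B'. Gamma_p (frac (z + y)) :: 'p padic)"
      "(\<Prod>z\<in>#B. Gamma_p (frac (z + x))) = (\<Prod>z\<in>#A'. Gamma_p (frac (z - y)) :: 'p padic)"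
      "(\<Sum>z\<in>#A. frac (z - x)) = (\<Sum>z\<in>#B'. frac (z + y))"
      "(\<Sum>z\<in>#B. frac (z + x)) = (\<Sum>z\<in>#A'. frac (z - y))"
    unfolding A[symmetric] B[symmetric] multiset.map_comp o_def up low by (rule refl)+
  have nz: "(\<Prod>z\<in>#M. Gamma_p z) \<noteq> (0 :: 'p padic)" for M
    using Gamma_p_nonzero[OF odd] by (induction M) simp_all
  have "C \<noteq> 0"
  proof
    assume "C = 0"
    then show False using gamma nz[of A'] nz[of B'] by simp
  qed
  then show ?thesis
    using nz unfolding hyper_term_def num sum gamma by (simp add: field_simps)
qed

text \<open>
  The terms are matched by an involution \<open>k\<close> of the summation range with \<open>j + k j\<close> congruent to \<open>(p - 1)/2\<close>
  modulo \<open>p - 1\<close>. The constant collects \<open>c\<close> from the gamma values, \<open>\<phi>(lam)\<close> from the character and, from the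
  sign \<open>(-1) ^ (j n)\<close>, the \<open>n\<close>-th power of \<open>\<phi>(-1)\<close>, where \<open>n\<close> is the number of upper parameters.
\<close>

lemma hyper_G_reflect:
  fixes lam :: "'p::prime_card mod_ring"
  assumes odd: "odd CARD('p)" and lam: "lam \<noteq> 0"
    and len: "length b = length a" "length a' = length a" "length b' = length a"
    and AB: "A = mset (map frac a)" "B = mset (map (\<lambda>r. frac (- r)) b)"
      "A' = mset (map frac a')" "B' = mset (map (\<lambda>r. frac (- r)) b')"
    and A: "image_mset (\<lambda>z. frac (z + 1/2)) B' = A"
    and B: "image_mset (\<lambda>z. frac (z + 1/2)) A' = B"
    and sum: "\<Sum>\<^sub># A' + \<Sum>\<^sub># B' = \<Sum>\<^sub># A + \<Sum>\<^sub># B"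
    and gamma: "(\<Prod>z\<in>#A'. Gamma_p z) * (\<Prod>z\<in>#B'. Gamma_p z)
      = (of_int c * ((\<Prod>z\<in>#A. Gamma_p z) * (\<Prod>z\<in>#B. Gamma_p z)) :: 'p padic)"
  shows "hyper_G a b lam = of_int (quad_char (- 1 :: 'p mod_ring) ^ length a * quad_char lam * c)
    * hyper_G a' b' (1 / lam)"
proof -
  let ?p = "CARD('p)" and ?n = "length a"
  define h where "h = (?p - 1) div 2"
  have p: "prime ?p" by (rule prime_card)
  have h: "?p - 1 = 2 * h" using odd by (simp add: h_def)
  have "?p > 1" using prime_gt_1_nat[OF p] .
  then have h0: "h > 0" using h by linarith
  have range: "{0..?p - 2} = {..<2 * h}" using h h0 by auto
  \<comment> \<open>\<open>h - j\<close> reduced modulo \<open>2 * h\<close>, without truncated subtraction.\<close>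
  define k where "k j = (if j \<le> h then h - j else 3 * h - j)" for j
  define e :: int where "e = quad_char (- 1 :: 'p mod_ring) ^ ?n * quad_char lam * c"
  define L R where
    "L j = (- 1) ^ (j * ?n) * omega_bar_pow j lam * hyper_term A B (of_nat j / of_nat (2 * h))" and
    "R j = (- 1) ^ (j * ?n) * omega_bar_pow j (1 / lam) * hyper_term A' B' (of_nat j / of_nat (2 * h))"
    for j
  have "L j = of_int e * R (k j)" if j: "j < 2 * h" for j
  proof -
    obtain s where s: "j + k j = h + 2 * h * s"
    proof (cases "j \<le> h")
      case True
      then show ?thesis using that[of 0] by (simp add: k_def)
    next
      case False
      then show ?thesis using that[of 1] j by (simp add: k_def)
    qed
    have "[j + k j = h] (mod 2 * h)" by (simp add: s cong_def)
    then have omega: "omega_bar_pow j lam = of_int (quad_char lam) * omega_bar_pow (k j) (1 / lam)"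
      by (rule omega_bar_pow_reflect[OF odd lam, of j "k j", folded h_def, unfolded h])
    have "of_nat j / of_nat (2 * h) + of_nat (k j) / of_nat (2 * h) - 1 / 2
        = (of_nat (j + k j) / of_nat (2 * h) - 1 / 2 :: rat)"
      by (simp only: of_nat_add add_divide_distrib)
    also have "\<dots> = of_nat s"
      unfolding s using h0 by (simp add: field_simps)
    finally have "of_nat j / of_nat (2 * h) + of_nat (k j) / of_nat (2 * h) - 1 / 2 \<in> (\<int> :: rat set)"
      by simp
    then have ht: "hyper_term A B (of_nat j / of_nat (2 * h))
        = of_int c * (hyper_term A' B' (of_nat (k j) / of_nat (2 * h)) :: 'p padic)"
      by (rule hyper_term_reflect[OF odd A B sum gamma])
    have "(- 1 :: 'p padic) ^ (j * ?n) = ((- 1) ^ h) ^ ?n * (- 1) ^ (k j * ?n)"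
    proof -
      have "even (j * ?n) \<longleftrightarrow> even ((h + k j) * ?n)"
        using arg_cong[OF s, of even] by auto
      then have "(- 1 :: 'p padic) ^ (j * ?n) = (- 1) ^ ((h + k j) * ?n)"
        by (simp only: minus_one_power_iff)
      then show ?thesis by (simp add: add_mult_distrib power_add power_mult)
    qed
    then have sgn: "(- 1 :: 'p padic) ^ (j * ?n)
        = of_int (quad_char (- 1 :: 'p mod_ring) ^ ?n) * (- 1) ^ (k j * ?n)"
      by (simp add: quad_char_minus_1[OF odd] h_def[symmetric, simplified])
    show ?thesis
      unfolding L_def R_def sgn omega ht e_def by (simp add: mult_ac)
  qed
  then have "(\<Sum>j<2 * h. L j) = (\<Sum>j<2 * h. of_int e * R (k j))"
    by (intro sum.cong) auto
  also have "\<dots> = (\<Sum>j<2 * h. of_int e * R j)"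
    by (rule sum.reindex_bij_witness[of _ k k]) (use h0 in \<open>auto simp: k_def\<close>)
  also have "\<dots> = of_int e * (\<Sum>j<2 * h. R j)"
    by (rule sum_distrib_left[symmetric])
  finally have "(\<Sum>j<2 * h. L j) = of_int e * (\<Sum>j<2 * h. R j)" .
  then show ?thesis
    unfolding hyper_G_conv_hyper_term[OF len(1)] hyper_G_conv_hyper_term[OF len(3)[folded len(2)]]
      AB[symmetric] range h e_def[symmetric] len(2) L_def R_def
    by (simp add: mult_ac)
qed

section \<open>Parameter multisets of equally spaced fractions\<close>

lemma frac_of_int_div_of_nat:
  assumes "N > 0"
  shows "frac (of_int z / of_nat N :: rat) = of_nat (nat (z mod int N)) / of_nat N"
proof -
  have "z mod int N \<ge> 0" "z mod int N < int N" using assms by simp_all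
  then have "nat (z mod int N) < N" by linarith
  have "of_int z = (of_int (z div int N * int N + z mod int N) :: rat)" by simp
  also have "\<dots> = of_int (z div int N) * of_nat N + of_int (z mod int N)"
    by (simp only: of_int_add of_int_mult of_int_of_nat_eq)
  also have "of_int (z mod int N) = (of_nat (nat (z mod int N)) :: rat)"
    using \<open>z mod int N \<ge> 0\<close> by simp
  finally have "of_int z / of_nat N
      = (of_nat (nat (z mod int N)) / of_nat N + of_int (z div int N) :: rat)"
    using assms by (simp add: field_simps)
  then have "frac (of_int z / of_nat N :: rat) = frac (of_nat (nat (z mod int N)) / of_nat N)"
    by (simp only: frac_add_of_int_right)
  also have "\<dots> = of_nat (nat (z mod int N)) / of_nat N"
    using \<open>nat (z mod int N) < N\<close> by (simp add: frac_eq divide_less_eq)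
  finally show ?thesis .
qed

text \<open>
  The criterion by which negated and shifted parameter lists are recognised: the fractional part of a fraction with
  denominator \<open>N\<close> is its numerator modulo \<open>N\<close>, divided by \<open>N\<close>, so it is enough that the numerators hit the
  expected residues without repetition.
\<close>

lemma mset_frac_residues:
  assumes N: "N > 0" and dist: "distinct xs" "distinct rs" and len: "length xs = length rs"
    and res: "\<And>k. k \<in> set xs \<Longrightarrow> nat (f k mod int N) \<in> set rs"
    and inj: "\<And>k l. k \<in> set xs \<Longrightarrow> l \<in> set xs \<Longrightarrow> int N dvd f k - f l \<Longrightarrow> k = l"
  shows "mset (map (\<lambda>k. frac (of_int (f k) / of_nat N :: rat)) xs)
    = mset (map (\<lambda>r. of_nat r / of_nat N) rs)"
proof -
  define g where "g k = nat (f k mod int N)" for k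
  have inj': "inj_on g (set xs)"
  proof (rule inj_onI)
    fix k l assume kl: "k \<in> set xs" "l \<in> set xs" "g k = g l"
    moreover have "f k mod int N \<ge> 0" "f l mod int N \<ge> 0" using N by simp_all
    ultimately have "f k mod int N = f l mod int N" by (simp add: g_def)
    then show "k = l" using inj kl by (simp add: mod_eq_dvd_iff)
  qed
  have sub: "set (map g xs) \<subseteq> set rs" using res by (auto simp: g_def)
  have d: "distinct (map g xs)" using dist inj' by (simp add: distinct_map)
  have "card (set (map g xs)) = card (set rs)"
    using distinct_card[OF d] distinct_card[OF dist(2)] len by simp
  then have "set (map g xs) = set rs" using sub by (intro card_subset_eq) auto
  then have "mset (map g xs) = mset rs" using set_eq_iff_mset_eq_distinct[OF d dist(2)] by blast
  then have "image_mset (\<lambda>r. of_nat r / of_nat N :: rat) (mset (map g xs))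
      = image_mset (\<lambda>r. of_nat r / of_nat N) (mset rs)" by simp
  then show ?thesis
    by (simp add: frac_of_int_div_of_nat[OF N] g_def multiset.map_comp o_def)
qed

definition uniform_fracs :: "nat \<Rightarrow> rat multiset" where
  "uniform_fracs N = mset (map (\<lambda>h. of_nat h / of_nat N) [0..<N])"

definition half_fracs :: "nat \<Rightarrow> rat multiset" where
  "half_fracs N = mset (map (\<lambda>h. of_nat (2 * h + 1) / of_nat (2 * N)) [0..<N])"

lemma uniform_fracs_Suc:
  assumes "N > 0"
  shows "uniform_fracs N = add_mset 0 (mset (map (\<lambda>k. of_nat k / of_nat N) [1..<N]))"
  using assms by (simp add: uniform_fracs_def upt_conv_Cons)

lemma sum_uniform_fracs:
  assumes "N > 0"
  shows "\<Sum>\<^sub># (uniform_fracs N) = (of_nat N - 1) / 2"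
proof -
  have "\<Sum>\<^sub># (uniform_fracs N) = (\<Sum>h<N. of_nat h / of_nat N)"
    by (simp only: uniform_fracs_def sum_mset_sum_list sum_list_distinct_conv_sum_set distinct_upt
        set_upt atLeast0LessThan)
  also have "\<dots> = (\<Sum>h<N. of_nat h) / of_nat N" by (rule sum_divide_distrib[symmetric])
  also have "(\<Sum>h<N. of_nat h) = (of_nat N * (of_nat N - 1) / 2 :: rat)"
    by (induction N) (simp_all add: field_simps)
  finally show ?thesis using assms by simp
qed

lemma sum_half_fracs:
  assumes "N > 0"
  shows "\<Sum>\<^sub># (half_fracs N) = of_nat N / 2"
proof -
  have "\<Sum>\<^sub># (half_fracs N) = (\<Sum>h<N. of_nat (2 * h + 1) / of_nat (2 * N))"
    by (simp only: half_fracs_def sum_mset_sum_list sum_list_distinct_conv_sum_set distinct_upt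
        set_upt atLeast0LessThan)
  also have "\<dots> = (\<Sum>h<N. of_nat (2 * h + 1)) / of_nat (2 * N)" by (rule sum_divide_distrib[symmetric])
  also have "(\<Sum>h<N. of_nat (2 * h + 1)) = (of_nat N * of_nat N :: rat)"
    by (induction N) (simp_all add: algebra_simps)
  finally show ?thesis using assms by simp
qed

lemma mset_map_filter_remove:
  assumes "distinct xs" "y \<in> set xs" "\<And>x. x \<in> set xs \<Longrightarrow> P x \<longleftrightarrow> x \<noteq> y"
  shows "mset (map g xs) = add_mset (g y) (mset (map g (filter P xs)))"
proof -
  have "filter P xs = filter (\<lambda>x. y \<noteq> x) xs"
    using assms(3) by (intro filter_cong) auto
  also have "\<dots> = remove1 y xs"
    using assms(1) by (simp add: distinct_remove1_removeAll removeAll_filter_not_eq)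
  finally have "mset (filter P xs) = mset xs - {#y#}" by simp
  then have "mset xs = add_mset y (mset (filter P xs))"
    using assms(2) by simp
  then show ?thesis by (simp only: mset_map image_mset_add_mset)
qed

lemma concat_map_if: "concat (map (\<lambda>x. if P x then [f x] else []) xs) = map f (filter P xs)"
  by (induction xs) simp_all

lemma Gamma_p_0:
  assumes "odd CARD('p)"
  shows "Gamma_p 0 = (1 :: 'p::prime_card padic)"
proof -
  have "\<not> CARD('p) dvd 1"
    using prime_card[where 'a='p] not_prime_unit by auto
  from padic_of_rat_mult[OF this, of 0] have "padic_of_rat 0 = (0 :: 'p padic_int)" by simp
  then show ?thesis by (simp add: Gamma_p_def padic_gamma_spec(3)[OF assms])
qed

text \<open>
  The multiplication formula solved for the half-integral product; the Legendre symbol is its own inverse.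
\<close>

lemma prod_Gamma_p_half_fracs:
  assumes odd: "odd CARD('p::prime_card)" and N: "\<not> CARD('p) dvd N"
  shows "(\<Prod>z\<in>#half_fracs N. Gamma_p z)
    = of_int (Legendre (int N) (int CARD('p))) * (\<Prod>z\<in>#uniform_fracs N. Gamma_p z)
      * (Gamma_p (1/2) :: 'p padic)"
proof -
  let ?e = "Legendre (int N) (int CARD('p))"
  have fract_prod: "to_fract (\<Prod>i\<in>I. g i) = (\<Prod>i\<in>I. to_fract (g i))"
    for I :: "nat set" and g :: "nat \<Rightarrow> 'p padic_int"
    by (induction I rule: infinite_finite_induct) simp_all
  have half: "(\<Prod>z\<in>#half_fracs N. Gamma_p z :: 'p padic)
      = (\<Prod>h<N. Gamma_p (of_nat (2 * h + 1) / of_nat (2 * N)))"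
    by (simp only: half_fracs_def mset_map multiset.map_comp o_def mset_upt prod_unfold_prod_mset
        atLeast0LessThan)
  have unif: "(\<Prod>z\<in>#uniform_fracs N. Gamma_p z :: 'p padic)
      = (\<Prod>h<N. Gamma_p (of_nat h / of_nat N))"
    by (simp only: uniform_fracs_def mset_map multiset.map_comp o_def mset_upt prod_unfold_prod_mset
        atLeast0LessThan)
  have "(\<Prod>z\<in>#half_fracs N. Gamma_p z) * of_int ?e
      = (\<Prod>z\<in>#uniform_fracs N. Gamma_p z) * (Gamma_p (1/2) :: 'p padic)"
    unfolding half unif
    using arg_cong[OF padic_gamma_multiplication_half[OF odd N], of to_fract]
    by (simp only: fract_prod to_fract_mult to_fract_of_int Gamma_p_def[symmetric]
        of_nat_1 of_nat_numeral)
  then have "of_int ?e * ((\<Prod>z\<in>#half_fracs N. Gamma_p z) * of_int ?e)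
      = of_int ?e * (\<Prod>z\<in>#uniform_fracs N. Gamma_p z) * (Gamma_p (1/2) :: 'p padic)"
    by (simp only: mult.assoc)
  moreover have "?e * ?e = 1"
    using N by (auto simp: Legendre_def cong_0_iff)
  then have "of_int ?e * (x * of_int ?e) = x" for x :: "'p padic"
    by (simp only: mult.left_commute[of "of_int ?e"] of_int_mult[symmetric] of_int_1 mult_1_right)
  ultimately show ?thesis by (simp only:)
qed

lemma mset_map_frac_uniform:
  assumes "N > 0" and "s \<in> {1, - 1}"
    and "\<And>k. k < N \<Longrightarrow> g k = of_int (c + s * int k) / of_nat N"
  shows "mset (map (\<lambda>k. frac (g k)) [0..<N]) = uniform_fracs N"
proof -
  have "mset (map (\<lambda>k. frac (of_int (c + s * int k) / of_nat N)) [0..<N]) = uniform_fracs N"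
    unfolding uniform_fracs_def
  proof (rule mset_frac_residues[OF assms(1)])
    fix k assume "k \<in> set [0..<N]"
    show "nat ((c + s * int k) mod int N) \<in> set [0..<N]"
      using assms(1) by (simp add: nat_less_iff)
  next
    fix k l assume kl: "k \<in> set [0..<N]" "l \<in> set [0..<N]"
      and dvd: "int N dvd c + s * int k - (c + s * int l)"
    have "int N dvd int k - int l"
      using assms(2) dvd by (auto simp: dvd_diff_commute)
    then have "[k = l] (mod N)" by (simp add: cong_iff_dvd_diff flip: cong_int_iff)
    then show "k = l" using kl by (simp add: cong_def)
  qed simp_all
  moreover have "map (\<lambda>k. frac (g k)) [0..<N]
      = map (\<lambda>k. frac (of_int (c + s * int k) / of_nat N)) [0..<N]"
    using assms(3) by simp
  ultimately show ?thesis by (simp only:)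
qed

text \<open>
  The numerators move by \<open>N/2\<close>.
\<close>

lemma uniform_fracs_half_shift:
  assumes N: "N > 0" "even N"
  shows "image_mset (\<lambda>z. frac (z + 1/2)) (uniform_fracs N) = uniform_fracs N"
proof -
  obtain e where e: "N = 2 * e" using N by blast
  have "mset (map (\<lambda>k. frac (of_nat k / of_nat N + 1/2)) [0..<N]) = uniform_fracs N"
    by (rule mset_map_frac_uniform[OF N(1), of 1 _ "int e"])
      (use N(1) in \<open>simp_all add: e field_simps\<close>)
  then show ?thesis by (simp add: uniform_fracs_def multiset.map_comp o_def)
qed

text \<open>
  The fraction \<open>(2k + 1)/(2N) + 1/2\<close> is \<open>(k + (N + 1)/2)/N\<close>, and \<open>(N + 1)/2\<close> is an integer.
\<close>

lemma half_fracs_half_shift: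
  assumes N: "odd N"
  shows "image_mset (\<lambda>z. frac (z + 1/2)) (half_fracs N) = uniform_fracs N"
proof -
  obtain e where e: "N = 2 * e + 1" using N by (elim oddE)
  have "mset (map (\<lambda>k. frac (of_nat (2 * k + 1) / of_nat (2 * N) + 1/2)) [0..<N]) = uniform_fracs N"
  proof (rule mset_map_frac_uniform[of N 1 _ "int e + 1"])
    fix k
    have "of_nat (2 * k + 1) / of_nat (2 * N) + 1/2 = (of_nat (2 * k + 1 + N) / of_nat (2 * N) :: rat)"
    proof -
      have "of_nat N / of_nat (2 * N) = (1/2 :: rat)" using odd_pos[OF N] by simp
      then show ?thesis by (simp only: of_nat_add[of "2 * k + 1" N] add_divide_distrib)
    qed
    also have "2 * k + 1 + N = 2 * (e + 1 + k)" using e by simp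
    also have "of_nat (2 * (e + 1 + k)) / of_nat (2 * N) = (of_nat (e + 1 + k) / of_nat N :: rat)"
      by (simp only: of_nat_mult of_nat_numeral)
    finally show "of_nat (2 * k + 1) / of_nat (2 * N) + 1/2
        = (of_int (int e + 1 + 1 * int k) / of_nat N :: rat)" by simp
  qed (use e in simp_all)
  then show ?thesis by (simp add: half_fracs_def multiset.map_comp o_def)
qed

text \<open>
  The lower parameter omitted from the full list is the one that the half shift would send to 0, the
  residue missing from the upper parameters \<open>1/N, ..., (N-1)/N\<close>.
\<close>

lemma half_shift_remove_half:
  assumes "N > 0" and "image_mset (\<lambda>z. frac (z + 1/2)) X = uniform_fracs N"
    and "X = add_mset (1/2) Y"
  shows "image_mset (\<lambda>z. frac (z + 1/2)) Y = mset (map (\<lambda>k. of_nat k / of_nat N) [1..<N])"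
proof -
  have "frac (1/2 + 1/2 :: rat) = 0" by simp
  then show ?thesis
    using assms uniform_fracs_Suc[OF assms(1)] by simp
qed

lemma mset_frac_lower_uniform:
  assumes "N > 0"
  shows "mset (map (\<lambda>h. frac (- (of_nat h / of_nat N))) [0..<N]) = uniform_fracs N"
  by (rule mset_map_frac_uniform[OF assms, of "- 1" _ 0]) simp_all

text \<open>
  Negation modulo 1 sends the odd numerator \<open>2k - 1\<close> over \<open>2N\<close> to \<open>2(N - k) + 1\<close>.
\<close>

lemma mset_frac_lower_half:
  assumes N: "N > 0"
  shows "mset (map (\<lambda>k. frac (- (of_nat (2 * k - 1) / of_nat (2 * N)))) [1..<N + 1]) = half_fracs N"
proof -
  have "mset (map (\<lambda>k. frac (of_int (- int (2 * k - 1)) / of_nat (2 * N) :: rat)) [1..<N + 1])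
      = mset (map (\<lambda>r. of_nat r / of_nat (2 * N)) (map (\<lambda>h. 2 * h + 1) [0..<N]))"
  proof (rule mset_frac_residues)
    fix k assume k: "k \<in> set [1..<N + 1]"
    have "(- int (2 * k - 1)) mod int (2 * N) = (- int (2 * k - 1) + int (2 * N)) mod int (2 * N)"
      by (rule mod_add_self2[symmetric])
    also have "- int (2 * k - 1) + int (2 * N) = int (2 * (N - k) + 1)"
    proof -
      have "int (2 * k - 1) = 2 * int k - 1" "int (N - k) = int N - int k" using k by auto
      then show ?thesis by simp
    qed
    also have "\<dots> mod int (2 * N) = int (2 * (N - k) + 1)"
      using k by (intro mod_pos_pos_trivial) auto
    finally have "nat (- int (2 * k - 1) mod int (2 * N)) = 2 * (N - k) + 1" by simp
    moreover have "N - k \<in> {0..<N}" using k by auto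
    ultimately show "nat (- int (2 * k - 1) mod int (2 * N)) \<in> set (map (\<lambda>h. 2 * h + 1) [0..<N])"
      by simp
  next
    fix k l assume kl: "k \<in> set [1..<N + 1]" "l \<in> set [1..<N + 1]"
      "int (2 * N) dvd - int (2 * k - 1) - - int (2 * l - 1)"
    have "- int (2 * k - 1) - - int (2 * l - 1) = 2 * (int l - int k)"
    proof -
      have "int (2 * k - 1) = 2 * int k - 1" "int (2 * l - 1) = 2 * int l - 1" using kl by auto
      then show ?thesis by simp
    qed
    then have "2 * int N dvd 2 * (int l - int k)" using kl(3) by (simp only: of_nat_mult of_nat_numeral)
    then have "int N dvd int l - int k" by (simp only: dvd_mult_cancel_left) simp
    moreover have "\<bar>int l - int k\<bar> < int N" using kl by auto
    ultimately have "int l - int k = 0"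
      using dvd_imp_le_int[of "int l - int k" "int N"] by linarith
    then show "k = l" by simp
  qed (use N in \<open>simp_all add: distinct_map inj_on_def\<close>)
  then show ?thesis by (simp add: half_fracs_def o_def)
qed

section \<open>The transformation formula\<close>

theorem theorem1p7:
  fixes d :: nat and lam :: "'p::prime_card mod_ring"
  assumes "d \<ge> 2" and "odd CARD('p)" and "\<not> CARD('p) dvd d * (d - 1)" and "lam \<noteq> 0"
  shows "(even d \<longrightarrow>
      hyper_G [of_nat k / of_nat d. k \<leftarrow> [1..<d]]
              [of_nat k / of_nat (d - 1). k \<leftarrow> [0..<d - 1]] lam
      = of_int (quad_char (- lam * of_nat (d - 1))) *
        hyper_G [of_nat (2 * k - 1) / of_nat (2 * (d - 1)). k \<leftarrow> [1..<d]]
                [of_nat h / of_nat d. h \<leftarrow> [0..<d], h \<noteq> d div 2] (1 / lam))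
    \<and> (odd d \<longrightarrow>
      hyper_G [of_nat k / of_nat d. k \<leftarrow> [1..<d]]
              [of_nat k / of_nat (d - 1). k \<leftarrow> [0..<d - 1]] lam
      = of_int (quad_char (of_nat d * lam)) *
        hyper_G [of_nat h / of_nat (d - 1). h \<leftarrow> [0..<d - 1]]
                [of_nat (2 * k - 1) / of_nat (2 * d). k \<leftarrow> [1..<d + 1], 2 * k - 1 \<noteq> d] (1 / lam))"
proof -
  let ?p = "CARD('p)"
  define m where "m = d - 1"
  have odd: "odd ?p" by fact
  have m: "m > 0" "d = Suc m" using assms(1) by (simp_all add: m_def)
  have d: "d > 0" using assms(1) by simp
  have pm: "\<not> ?p dvd m" and pd: "\<not> ?p dvd d" using assms(3) by (auto simp: m_def)
  define a b where "a = map (\<lambda>k. of_nat k / of_nat d :: rat) [1..<d]"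
    and "b = map (\<lambda>k. of_nat k / of_nat m :: rat) [0..<m]"
  define D where "D = mset (map (\<lambda>k. of_nat k / of_nat d :: rat) [1..<d])"
  define G where "G M = (\<Prod>z\<in>#M. Gamma_p z :: 'p padic)" for M
  have Ud: "uniform_fracs d = add_mset 0 D"
    unfolding D_def by (rule uniform_fracs_Suc[OF d])
  have GD: "G D = G (uniform_fracs d)" by (simp add: Ud G_def Gamma_p_0[OF odd])
  have SD: "\<Sum>\<^sub># D = (of_nat d - 1) / 2" using sum_uniform_fracs[OF d] by (simp add: Ud)
  have half: "G (half_fracs N) = of_int (quad_char (of_nat N :: 'p mod_ring)) * G (uniform_fracs N)
      * Gamma_p (1/2)" if "\<not> ?p dvd N" for N
    unfolding G_def quad_char_of_nat by (rule prod_Gamma_p_half_fracs[OF odd that])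
  have frac_less: "frac (of_nat r / of_nat N) = (of_nat r / of_nat N :: rat)" if "r < N" for r N
    using that by (simp add: frac_eq divide_less_eq)
  have upper: "mset (map frac a) = D"
  proof -
    have "map frac a = map (\<lambda>k. of_nat k / of_nat d) [1..<d]"
      unfolding a_def map_map o_def by (intro map_cong refl frac_less) simp
    then show ?thesis by (simp only: D_def)
  qed
  have lower: "mset (map (\<lambda>r. frac (- r)) b) = uniform_fracs m"
    unfolding b_def map_map o_def by (rule mset_frac_lower_uniform[OF m(1)])
  have half_neq: "1/2 = frac (- (1/2) :: rat)" by (simp add: frac_neg)
  show ?thesis
    unfolding concat_map_if m_def[symmetric] a_def[symmetric] b_def[symmetric]
  proof (intro conjI impI)
    assume even_d: "even d"
    define a' b' where "a' = map (\<lambda>k. of_nat (2 * k - 1) / of_nat (2 * m) :: rat) [1..<d]"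
      and "b' = map (\<lambda>h. of_nat h / of_nat d :: rat) (filter (\<lambda>h. h \<noteq> d div 2) [0..<d])"
    define B' where "B' = mset (map (\<lambda>r. frac (- r)) b')"
    have upper': "mset (map frac a') = half_fracs m"
    proof -
      have "[1..<d] = map Suc [0..<m]" using m by (simp add: map_Suc_upt)
      then have "map frac a' = map (\<lambda>h. of_nat (2 * h + 1) / of_nat (2 * m)) [0..<m]"
        unfolding a'_def
        by (simp only: map_map o_def) (intro map_cong refl, subst frac_less, auto)
      then show ?thesis by (simp only: half_fracs_def)
    qed
    have "mset (map (\<lambda>h. frac (- (of_nat h / of_nat d) :: rat)) [0..<d])
        = add_mset (frac (- (of_nat (d div 2) / of_nat d))) B'"
      unfolding B'_def b'_def map_map o_def
      by (rule mset_map_filter_remove) (use d in auto)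
    also have "of_nat (d div 2) / of_nat d = (1/2 :: rat)"
      using even_d d by (auto elim!: evenE)
    finally have lower': "uniform_fracs d = add_mset (1/2) B'"
      by (simp only: mset_frac_lower_uniform[OF d] half_neq[symmetric])
    then have GB': "G (uniform_fracs d) = Gamma_p (1/2) * G B'" by (simp add: G_def)
    have SB': "\<Sum>\<^sub># B' = (of_nat d - 1) / 2 - 1/2"
      using sum_uniform_fracs[OF d] by (simp add: lower' field_simps)
    have "size (uniform_fracs d) = Suc (size B')" by (simp add: lower')
    then have lb': "length b' = m" by (simp add: uniform_fracs_def B'_def m)
    have "hyper_G a b lam = of_int (quad_char (- 1 :: 'p mod_ring) ^ length a * quad_char lam
        * quad_char (of_nat m :: 'p mod_ring)) * hyper_G a' b' (1 / lam)"
    proof (rule hyper_G_reflect[OF odd assms(4) _ _ _ upper[symmetric] lower[symmetric]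
          upper'[symmetric] B'_def])
      show "image_mset (\<lambda>z. frac (z + 1/2)) B' = D"
        unfolding D_def
        by (rule half_shift_remove_half[OF d uniform_fracs_half_shift[OF d even_d] lower'])
      show "image_mset (\<lambda>z. frac (z + 1/2)) (half_fracs m) = uniform_fracs m"
        using even_d m by (intro half_fracs_half_shift) simp
      show "\<Sum>\<^sub># (half_fracs m) + \<Sum>\<^sub># B' = \<Sum>\<^sub># D + \<Sum>\<^sub># (uniform_fracs m)"
        using m by (simp add: sum_half_fracs sum_uniform_fracs SB' SD field_simps)
      show "(\<Prod>z\<in>#half_fracs m. Gamma_p z) * (\<Prod>z\<in>#B'. Gamma_p z)
        = of_int (quad_char (of_nat m :: 'p mod_ring)) *
          ((\<Prod>z\<in>#D. Gamma_p z) * (\<Prod>z\<in>#uniform_fracs m. Gamma_p z) :: 'p padic)"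
        unfolding G_def[symmetric] GD GB' half[OF pm] by (simp add: mult_ac)
    qed (simp_all add: a_def b_def a'_def lb' m)
    also have "quad_char (- 1 :: 'p mod_ring) ^ length a = quad_char (- 1 :: 'p mod_ring)"
      using even_d m by (simp add: a_def quad_char_minus_1[OF odd] power_mult[symmetric]
          minus_one_power_iff)
    also have "quad_char (- 1 :: 'p mod_ring) * quad_char lam * quad_char (of_nat m :: 'p mod_ring)
        = quad_char (- lam * of_nat m)"
    proof -
      have "of_nat m \<noteq> (0 :: 'p mod_ring)" using pm of_nat_0_mod_ring_dvd by blast
      then show ?thesis
        using assms(4) by (simp add: quad_char_mult[OF odd, symmetric])
    qed
    finally show "hyper_G a b lam = of_int (quad_char (- lam * of_nat m)) *
        hyper_G a' b' (1 / lam)" .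
  next
    assume odd_d: "odd d"
    define b' where "b' = map (\<lambda>k. of_nat (2 * k - 1) / of_nat (2 * d) :: rat)
          (filter (\<lambda>k. 2 * k - 1 \<noteq> d) [1..<d + 1])"
    define B' where "B' = mset (map (\<lambda>r. frac (- r)) b')"
    have upper': "mset (map frac b) = uniform_fracs m"
    proof -
      have "map frac b = map (\<lambda>k. of_nat k / of_nat m) [0..<m]"
        unfolding b_def map_map o_def by (intro map_cong refl frac_less) simp
      then show ?thesis by (simp only: uniform_fracs_def)
    qed
    have c: "2 * ((d + 1) div 2) - 1 = d" using odd_d by simp
    have "mset (map (\<lambda>k. frac (- (of_nat (2 * k - 1) / of_nat (2 * d)) :: rat)) [1..<d + 1])
        = add_mset (frac (- (of_nat (2 * ((d + 1) div 2) - 1) / of_nat (2 * d)))) B'"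
      unfolding B'_def b'_def map_map o_def
      by (rule mset_map_filter_remove) (use odd_d d in \<open>auto elim!: oddE\<close>)
    also have "of_nat (2 * ((d + 1) div 2) - 1) / of_nat (2 * d) = (1/2 :: rat)"
      unfolding c using d by simp
    finally have lower': "half_fracs d = add_mset (1/2) B'"
      by (simp only: mset_frac_lower_half[OF d] half_neq[symmetric])
    then have GB': "G (half_fracs d) = Gamma_p (1/2) * G B'" by (simp add: G_def)
    have SB': "\<Sum>\<^sub># B' = of_nat d / 2 - 1/2"
      using sum_half_fracs[OF d] by (simp add: lower' field_simps)
    have "size (half_fracs d) = Suc (size B')" by (simp add: lower')
    then have lb': "length b' = m" by (simp add: half_fracs_def B'_def m)
    have "hyper_G a b lam = of_int (quad_char (- 1 :: 'p mod_ring) ^ length a * quad_char lam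
        * quad_char (of_nat d :: 'p mod_ring)) * hyper_G b b' (1 / lam)"
    proof (rule hyper_G_reflect[OF odd assms(4) _ _ _ upper[symmetric] lower[symmetric]
          upper'[symmetric] B'_def])
      show "image_mset (\<lambda>z. frac (z + 1/2)) B' = D"
        unfolding D_def
        by (rule half_shift_remove_half[OF d half_fracs_half_shift[OF odd_d] lower'])
      show "image_mset (\<lambda>z. frac (z + 1/2)) (uniform_fracs m) = uniform_fracs m"
        using odd_d m by (intro uniform_fracs_half_shift) simp_all
      show "\<Sum>\<^sub># (uniform_fracs m) + \<Sum>\<^sub># B' = \<Sum>\<^sub># D + \<Sum>\<^sub># (uniform_fracs m)"
        by (simp add: SB' SD field_simps)
      have "Gamma_p (1/2) * G B' = Gamma_p (1/2) * (of_int (quad_char (of_nat d :: 'p mod_ring)) * G D)"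
        unfolding GB'[symmetric] half[OF pd] GD by (simp add: mult_ac)
      then have "G B' = of_int (quad_char (of_nat d :: 'p mod_ring)) * G D"
        using Gamma_p_nonzero[OF odd] by simp
      then show "(\<Prod>z\<in>#uniform_fracs m. Gamma_p z) * (\<Prod>z\<in>#B'. Gamma_p z)
        = of_int (quad_char (of_nat d :: 'p mod_ring)) *
          ((\<Prod>z\<in>#D. Gamma_p z) * (\<Prod>z\<in>#uniform_fracs m. Gamma_p z) :: 'p padic)"
        unfolding G_def[symmetric] by (simp add: mult_ac)
    qed (simp_all add: a_def b_def lb' m)
    moreover have "quad_char (- 1 :: 'p mod_ring) ^ length a = 1"
      using odd_d m by (simp add: a_def quad_char_minus_1[OF odd] minus_one_power_iff)
    moreover have "quad_char lam * quad_char (of_nat d :: 'p mod_ring) = quad_char (of_nat d * lam)"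
    proof -
      have "of_nat d \<noteq> (0 :: 'p mod_ring)" using pd of_nat_0_mod_ring_dvd by blast
      then show ?thesis
        using assms(4) by (simp add: quad_char_mult[OF odd])
    qed
    ultimately show "hyper_G a b lam = of_int (quad_char (of_nat d * lam)) *
        hyper_G b b' (1 / lam)"
      by (simp only: mult_1_left)
  qed
qed

end
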